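(* Let $k$ be an algebraically closed field of characteristic $0$, let $N\in\mathbb{N}$ (with $N\ge 1$), let $A\in \mathrm{GL}_N(k[x])$, and let $f:\mathbb{A}^1_k\times \mathbb{A}^N_k\longrightarrow \mathbb{A}^1_k\times \mathbb{A}^N_k$ be the automorphism given by $(x,y)\mapsto (x+1,A(x)y)$. Then there exists a constant $C$ depending only on $A$ such that for every periodic subvariety $V$ of $\mathbb{A}^1_k\times \mathbb{A}^N_k$ under the action of $f$, the period of $V$ is at most $C$.
   Context: Subvarieties are Zariski closed. An irreducible subvariety $V$ is periodic under the action of $f$ if $f^n(V)=V$ for some integer $n\ge 1$; its period is the smallest such $n$. *)

theory Defs
  imports
    "HOL-Analysis.Analysis"
    "HOL-Computational_Algebra.Polynomial"
    "HOL-Library.Poly_Mapping"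
begin

(* The points of A^1 x A^N over an algebraically closed field 'k are represented by
   pairs (x, y) in 'k x 'k^'n, where N = CARD('n).  The coordinate ring
   k[x, y_1, ..., y_N] = k[x][y_1, ..., y_N] is represented by finitely supported
   maps from exponent vectors in y to coefficients in k[x]. *)

type_synonym ('k, 'n) coord_ring = "('n \<Rightarrow>\<^sub>0 nat) \<Rightarrow>\<^sub>0 'k poly"

type_synonym ('k, 'n) points = "'k \<times> ('k ^ 'n)"

definition eval_coord :: "('k::comm_ring_1, 'n::finite) coord_ring \<Rightarrow> ('k, 'n) points \<Rightarrow> 'k" where
  "eval_coord p = (\<lambda>(x, y).
     \<Sum>m\<in>Poly_Mapping.keys p.
       poly (Poly_Mapping.lookup p m) x * (\<Prod>i\<in>UNIV. (y $ i) ^ Poly_Mapping.lookup m i))"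

definition zero_locus :: "('k::comm_ring_1, 'n::finite) coord_ring set \<Rightarrow> ('k, 'n) points set" where
  "zero_locus S = {z. \<forall>p\<in>S. eval_coord p z = 0}"

definition zariski_closed :: "('k::comm_ring_1, 'n::finite) points set \<Rightarrow> bool" where
  "zariski_closed V \<longleftrightarrow> (\<exists>S. V = zero_locus S)"

definition irreducible_subvariety :: "('k::comm_ring_1, 'n::finite) points set \<Rightarrow> bool" where
  "irreducible_subvariety V \<longleftrightarrow>
     zariski_closed V \<and> V \<noteq> {} \<and>
     (\<forall>V\<^sub>1 V\<^sub>2. zariski_closed V\<^sub>1 \<longrightarrow> zariski_closed V\<^sub>2 \<longrightarrow> V = V\<^sub>1 \<union> V\<^sub>2 \<longrightarrow> V = V\<^sub>1 \<or> V = V\<^sub>2)"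

definition periodic_subvariety ::
  "(('k::comm_ring_1, 'n::finite) points \<Rightarrow> ('k, 'n) points) \<Rightarrow> ('k, 'n) points set \<Rightarrow> bool" where
  "periodic_subvariety f V \<longleftrightarrow>
     irreducible_subvariety V \<and> (\<exists>n\<ge>1. (f ^^ n) ` V = V)"

(* meaningful only if some such n exists, i.e. for periodic V *)
definition period :: "('a \<Rightarrow> 'a) \<Rightarrow> 'a set \<Rightarrow> nat" where
  "period f V = (LEAST n. n \<ge> 1 \<and> (f ^^ n) ` V = V)"

definition shift_cocycle ::
  "'k::comm_ring_1 poly ^ 'n ^ 'n \<Rightarrow> ('k, 'n::finite) points \<Rightarrow> ('k, 'n) points" where
  "shift_cocycle A = (\<lambda>(x, y). (x + 1, map_matrix (\<lambda>p. poly p x) A *v y))"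

end

theory Submission
  imports Defs
begin

text \<open>
  The coefficients of \<open>A\<close> and \<open>A\<^sup>-\<^sup>1\<close> lie in a finitely generated domain \<open>R\<close> of characteristic 0.
  For every large prime \<open>p\<close> such a ring carries a separated filtration by ideals \<open>I s\<close> with
  \<open>I 1\<close> of finite index and containing \<open>p\<close>. Over \<open>R / I 1\<close> the products
  \<open>A(x + r - 1) \<cdots> A(x)\<close>, \<open>x\<close> a natural number, are trivial for some length \<open>r = m\<close>, and over
  \<open>R / I s\<close> they are trivial for length \<open>m p\<^sup>a\<close>, since the kernel of reduction is a \<open>p\<close>-group.

  Let \<open>V\<close> be periodic of period \<open>n = p\<^sup>b n'\<close> with \<open>n'\<close> prime to \<open>p\<close>. If \<open>P\<close> vanishes on \<open>V\<close>, so does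
  \<open>P \<circ> f\<^sup>r\<close> for \<open>n dvd r\<close>. If \<open>P \<circ> f\<^sup>L\<close> did not vanish on \<open>V\<close> for \<open>L = m p\<^sup>b\<close>, a linear functional over
  \<open>R[x]\<close> would separate its coefficients from those of all \<open>P \<circ> f\<^sup>r\<close>, giving polynomials \<open>U(r)\<close> over \<open>R\<close>
  with \<open>U(r) = 0\<close> for \<open>n dvd r\<close> but \<open>U(L) \<noteq> 0\<close>. Evaluated at a natural number, \<open>U(r)\<close> modulo \<open>I s\<close> depends
  only on \<open>r\<close> modulo \<open>m p\<^sup>a\<close>, and \<open>L\<close> is congruent to a multiple of \<open>n\<close>; so \<open>U(L)\<close> lies in every \<open>I s\<close>,
  a contradiction. Hence \<open>n\<close> divides \<open>m p\<^sup>b\<close>, and using two primes bounds \<open>n\<close>.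
\<close>

section \<open>Separated filtrations of finitely generated domains\<close>

text \<open>Rings are carrier sets inside one fixed type, so that generators can be adjoined one by
  one without changing the type of the coefficients of the matrices.\<close>

locale subring_of =
  fixes R :: "'a::comm_ring_1 set"
  assumes one_mem: "1 \<in> R"
    and diff_mem: "\<lbrakk>x \<in> R; y \<in> R\<rbrakk> \<Longrightarrow> x - y \<in> R"
    and mult_mem: "\<lbrakk>x \<in> R; y \<in> R\<rbrakk> \<Longrightarrow> x * y \<in> R"
begin

lemma zero_mem: "0 \<in> R"
  using diff_mem[OF one_mem one_mem] by simp

lemma uminus_mem: "x \<in> R \<Longrightarrow> - x \<in> R"
  using diff_mem[OF zero_mem, of x] by simp

lemma add_mem: "\<lbrakk>x \<in> R; y \<in> R\<rbrakk> \<Longrightarrow> x + y \<in> R"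
  using diff_mem[OF _ uminus_mem, of x y] by simp

lemma of_nat_mem: "of_nat n \<in> R"
  by (induction n) (auto intro: zero_mem one_mem add_mem)

lemma power_mem: "x \<in> R \<Longrightarrow> x ^ n \<in> R"
  by (induction n) (auto intro: one_mem mult_mem)

lemma sum_mem: "(\<And>i. i \<in> S \<Longrightarrow> g i \<in> R) \<Longrightarrow> sum g S \<in> R"
  by (induction S rule: infinite_finite_induct) (auto intro: zero_mem add_mem)

lemma prod_mem: "(\<And>i. i \<in> S \<Longrightarrow> g i \<in> R) \<Longrightarrow> prod g S \<in> R"
  by (induction S rule: infinite_finite_induct) (auto intro: one_mem mult_mem)

end

section \<open>Polynomials over a subring and adjunction of one element\<close>

definition polys_over :: "'a::zero set \<Rightarrow> 'a poly set" where
  "polys_over R = {q. \<forall>i. coeff q i \<in> R}"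

definition adjoin :: "'a::comm_ring_1 set \<Rightarrow> 'a \<Rightarrow> 'a set" where
  "adjoin R t = (\<lambda>q. poly q t) ` polys_over R"

context subring_of
begin

lemma polys_over_pCons: "pCons c q \<in> polys_over R \<longleftrightarrow> c \<in> R \<and> q \<in> polys_over R"
  by (auto simp: polys_over_def coeff_pCons split: nat.splits)

lemma poly_mem: "q \<in> polys_over R \<Longrightarrow> x \<in> R \<Longrightarrow> poly q x \<in> R"
  by (induction q) (auto simp: polys_over_pCons intro: zero_mem add_mem mult_mem)

lemma polys_over_subring: "subring_of (polys_over R)"
proof
  show "1 \<in> polys_over R"
    by (auto simp: polys_over_def one_mem zero_mem coeff_1)
  show "x - y \<in> polys_over R" if "x \<in> polys_over R" "y \<in> polys_over R" for x y
    using that by (auto simp: polys_over_def diff_mem)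
  show "x * y \<in> polys_over R" if "x \<in> polys_over R" "y \<in> polys_over R" for x y
    using that by (auto simp: polys_over_def coeff_mult intro!: sum_mem mult_mem)
qed

lemma const_in_polys_over: "[:c:] \<in> polys_over R \<longleftrightarrow> c \<in> R"
  by (auto simp: polys_over_pCons) (auto simp: polys_over_def zero_mem)

lemma linear_in_polys_over: "c \<in> R \<Longrightarrow> [:c, 1:] \<in> polys_over R"
  using const_in_polys_over[of 1] one_mem by (simp add: polys_over_pCons[of c])

lemma pcompose_in_polys_over:
  assumes "q \<in> polys_over R" "r \<in> polys_over R"
  shows "pcompose q r \<in> polys_over R"
proof -
  interpret P: subring_of "polys_over R" by (rule polys_over_subring)
  show ?thesis using assms(1)
    by (induction q)
       (auto simp: polys_over_pCons pcompose_pCons const_in_polys_over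
             intro!: P.add_mem P.mult_mem P.zero_mem assms)
qed

lemma adjoin_subring: "subring_of (adjoin R t)"
proof -
  interpret P: subring_of "polys_over R" by (rule polys_over_subring)
  show ?thesis
  proof
    show "1 \<in> adjoin R t"
      unfolding adjoin_def by (rule image_eqI[of _ _ 1]) (auto intro: P.one_mem)
    show "x - y \<in> adjoin R t" if "x \<in> adjoin R t" "y \<in> adjoin R t" for x y
    proof -
      from that obtain q r where "x = poly q t" "y = poly r t" "q \<in> polys_over R" "r \<in> polys_over R"
        by (auto simp: adjoin_def)
      then show ?thesis unfolding adjoin_def
        by (intro image_eqI[of _ _ "q - r"]) (auto intro: P.diff_mem)
    qed
    show "x * y \<in> adjoin R t" if "x \<in> adjoin R t" "y \<in> adjoin R t" for x y
    proof -
      from that obtain q r where "x = poly q t" "y = poly r t" "q \<in> polys_over R" "r \<in> polys_over R"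
        by (auto simp: adjoin_def)
      then show ?thesis unfolding adjoin_def
        by (intro image_eqI[of _ _ "q * r"]) (auto intro: P.mult_mem)
    qed
  qed
qed

lemma mem_adjoin: "x \<in> R \<Longrightarrow> x \<in> adjoin R t"
  unfolding adjoin_def by (rule image_eqI[of _ _ "[:x:]"]) (auto simp: const_in_polys_over)

lemma generator_mem_adjoin: "t \<in> adjoin R t"
  unfolding adjoin_def
  by (rule image_eqI[of _ _ "[:0, 1:]"]) (auto simp: linear_in_polys_over zero_mem)

lemma adjoin_shift:
  assumes "c \<in> R"
  shows "adjoin R (t - c) = adjoin R t"
proof
  have "pcompose q [:- c, 1:] \<in> polys_over R" "pcompose q [:c, 1:] \<in> polys_over R"
    if "q \<in> polys_over R" for q
    using that assms by (auto intro!: pcompose_in_polys_over linear_in_polys_over uminus_mem)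
  moreover have "poly q (t - c) = poly (pcompose q [:- c, 1:]) t"
    "poly q t = poly (pcompose q [:c, 1:]) (t - c)" for q
    by (simp_all add: poly_pcompose)
  ultimately show "adjoin R (t - c) \<subseteq> adjoin R t" "adjoin R t \<subseteq> adjoin R (t - c)"
    unfolding adjoin_def by blast+
qed

end

section \<open>Filtrations and the base case of the integers\<close>

text \<open>The axioms abstract the powers of an ideal with finite residue ring. The steps
  \<open>I s\<close> need not be actual powers: \<open>I_mult\<close> is only an inclusion, which
  survives both kinds of adjunction below.\<close>

locale adic_filtration = subring_of R for R :: "'a::comm_ring_1 set" +
  fixes I :: "nat \<Rightarrow> 'a set" and p :: nat
  assumes I_0: "I 0 = R"
    and I_Suc: "I (Suc s) \<subseteq> I s"
    and I_zero: "0 \<in> I s"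
    and I_add: "\<lbrakk>x \<in> I s; y \<in> I s\<rbrakk> \<Longrightarrow> x + y \<in> I s"
    and I_mult: "\<lbrakk>x \<in> I s; y \<in> I t\<rbrakk> \<Longrightarrow> x * y \<in> I (s + t)"
    and p_mem: "of_nat p \<in> I 1"
    and I_separated: "(\<And>s. x \<in> I s) \<Longrightarrow> x = 0"
    and I_finite_index: "\<exists>T. finite T \<and> T \<subseteq> R \<and> (\<forall>x\<in>R. \<exists>t\<in>T. x - t \<in> I 1)"
begin

lemma I_antimono: "s \<le> t \<Longrightarrow> I t \<subseteq> I s"
  using lift_Suc_antimono_le[of I s t] I_Suc by blast

lemma I_sub_R: "I s \<subseteq> R"
  using I_antimono[of 0 s] I_0 by simp

lemma I_scale: "\<lbrakk>c \<in> R; x \<in> I s\<rbrakk> \<Longrightarrow> c * x \<in> I s"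
  using I_mult[of c 0 x s] I_0 by simp

lemma I_scale_right: "\<lbrakk>c \<in> R; x \<in> I s\<rbrakk> \<Longrightarrow> x * c \<in> I s"
  using I_scale[of c x s] by (simp add: mult.commute)

lemma I_uminus: "x \<in> I s \<Longrightarrow> - x \<in> I s"
  using I_scale[of "- 1" x s] uminus_mem[OF one_mem] by simp

lemma I_diff: "\<lbrakk>x \<in> I s; y \<in> I s\<rbrakk> \<Longrightarrow> x - y \<in> I s"
  using I_add[of x s "- y"] I_uminus[of y s] by simp

lemma I_sum: "(\<And>i. i \<in> S \<Longrightarrow> g i \<in> I s) \<Longrightarrow> sum g S \<in> I s"
  by (induction S rule: infinite_finite_induct) (auto intro: I_zero I_add)

text \<open>One factor \<open>a\<close> is removed at a time, climbing the filtration: once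
  \<open>y\<close> is in \<open>I s\<close>, the element \<open>(a * b - 1) * y\<close> is in
  \<open>I (Suc s)\<close>, and so is \<open>b * (a * y)\<close>; their difference is
  \<open>y\<close>.\<close>

lemma unit_cancel:
  assumes "a \<in> R" "b \<in> R" "a * b - 1 \<in> I 1"
  shows "y \<in> R \<Longrightarrow> a ^ h * y \<in> I s \<Longrightarrow> y \<in> I s"
proof (induction h arbitrary: y)
  case (Suc h)
  have single: "a * y \<in> I s \<Longrightarrow> y \<in> I s" if "y \<in> R" for y s
  proof (induction s)
    case 0
    then show ?case using that I_0 by simp
  next
    case (Suc s)
    then have "y \<in> I s" using I_Suc by blast
    then have "(a * b - 1) * y \<in> I (Suc s)"
      using I_mult[OF assms(3)] by force
    moreover have "b * (a * y) \<in> I (Suc s)"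
      using Suc.prems assms(2) I_scale by blast
    ultimately have "b * (a * y) - (a * b - 1) * y \<in> I (Suc s)"
      by (rule I_diff[rotated])
    then show ?case by (simp add: algebra_simps)
  qed
  have "a ^ h * y \<in> R" using assms Suc.prems by (simp add: mult_mem power_mem)
  moreover have "a * (a ^ h * y) \<in> I s" using Suc.prems by (simp add: mult.assoc)
  ultimately show ?case using Suc single by blast
qed simp

end

text \<open>The unit condition is what allows a generator that is algebraic but not integral
  to be adjoined: its leading coefficient is kept invertible modulo the filtration.\<close>

definition good_ring :: "'a::comm_ring_1 set \<Rightarrow> bool" where
  "good_ring R \<longleftrightarrow> subring_of R \<and>
     (\<forall>a\<in>R. a \<noteq> 0 \<longrightarrow> (\<exists>B. \<forall>p>B. prime p \<longrightarrow>
        (\<exists>I. adic_filtration R I p \<and> (\<exists>b\<in>R. a * b - 1 \<in> I 1))))"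

text \<open>The filtration is the p-adic one, with steps \<open>p^s Z\<close>. A nonzero integer z
  is a unit modulo every prime larger than its absolute value, which gives the bound.\<close>

lemma good_ring_int: "good_ring (range of_int :: 'a::{comm_ring_1,ring_char_0} set)"
  unfolding good_ring_def
proof (intro conjI ballI impI)
  show sub: "subring_of (range of_int :: 'a set)"
  proof
    show "1 \<in> range of_int" by (metis of_int_1 rangeI)
  qed (auto simp flip: of_int_diff of_int_mult)
  fix a :: 'a assume "a \<in> range of_int" "a \<noteq> 0"
  then obtain z where z: "a = of_int z" "z \<noteq> 0" by auto
  show "\<exists>B. \<forall>p>B. prime p \<longrightarrow>
        (\<exists>I. adic_filtration (range of_int) I p \<and> (\<exists>b\<in>range of_int. a * b - 1 \<in> I 1))"
  proof (intro exI[of _ "nat \<bar>z\<bar>"] allI impI)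
    fix p :: nat assume p: "p > nat \<bar>z\<bar>" "prime p"
    define I where "I = (\<lambda>s. range (\<lambda>w. of_int (int p ^ s * w)) :: 'a set)"
    have I_iff: "of_int v \<in> I s \<longleftrightarrow> int p ^ s dvd v" for v s
      unfolding I_def by (auto simp: dvd_def image_iff simp del: of_int_mult of_int_power)
    have I_ex: "x \<in> I s \<Longrightarrow> \<exists>w. x = of_int w" for x s
      unfolding I_def by blast
    have "adic_filtration (range of_int :: 'a set) I p"
    proof (intro adic_filtration.intro sub adic_filtration_axioms.intro)
      show "I 0 = range of_int" by (simp add: I_def)
      show "I (Suc s) \<subseteq> I s" for s
        using I_ex I_iff by (metis dvd_mult_right power_Suc subsetI)
      show "0 \<in> I s" for s using I_iff[of 0] by simp
      show "x + y \<in> I s" if "x \<in> I s" "y \<in> I s" for x y s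
      proof -
        obtain v w where "x = of_int v" "y = of_int w" using I_ex \<open>x \<in> I s\<close> \<open>y \<in> I s\<close> by blast
        then show ?thesis using that by (metis I_iff dvd_add of_int_add)
      qed
      show "x * y \<in> I (s + t)" if "x \<in> I s" "y \<in> I t" for x y s t
      proof -
        obtain v w where vw: "x = of_int v" "y = of_int w"
          using I_ex \<open>x \<in> I s\<close> \<open>y \<in> I t\<close> by blast
        with that have "int p ^ s dvd v" "int p ^ t dvd w" by (simp_all only: I_iff)
        then have "int p ^ (s + t) dvd v * w" unfolding power_add by (rule mult_dvd_mono)
        then show ?thesis using vw I_iff[of "v * w" "s + t"] by simp
      qed
      show "of_nat p \<in> I 1" using I_iff[of "int p" 1] by simp
      show "x = 0" if "\<And>s. x \<in> I s" for x
      proof -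
        have "x \<in> I 0" by (rule that)
        then obtain v where v: "x = of_int v" using I_ex by blast
        have "v = 0"
        proof (rule ccontr)
          assume "v \<noteq> 0"
          moreover have "int p ^ nat \<bar>v\<bar> dvd v" using that v I_iff by auto
          ultimately have "\<bar>int p ^ nat \<bar>v\<bar>\<bar> \<le> \<bar>v\<bar>" by (rule dvd_imp_le_int)
          moreover have "nat \<bar>v\<bar> < p ^ nat \<bar>v\<bar>"
            using p(2) by (intro power_gt_expt prime_gt_Suc_0_nat)
          then have "int (nat \<bar>v\<bar>) < int (p ^ nat \<bar>v\<bar>)" by (simp only: of_nat_less_iff)
          then have "\<bar>v\<bar> < int p ^ nat \<bar>v\<bar>" by simp
          ultimately show False by simp
        qed
        then show ?thesis using v by simp
      qed
      show "\<exists>T. finite T \<and> T \<subseteq> range of_int \<and> (\<forall>x\<in>range of_int. \<exists>t\<in>T. x - t \<in> I 1)"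
      proof (intro exI[of _ "of_int ` {0..<int p}"] conjI ballI)
        fix x :: 'a assume "x \<in> range of_int"
        then obtain v where v: "x = of_int v" by auto
        have "x - of_int (v mod int p) \<in> I 1"
          using v I_iff[of "v - v mod int p" 1] by (simp add: dvd_minus_mod)
        moreover have "v mod int p \<in> {0..<int p}" using p by (auto simp: prime_gt_0_nat)
        ultimately show "\<exists>t\<in>of_int ` {0..<int p}. x - t \<in> I 1" by blast
      qed auto
    qed
    moreover have "\<exists>b\<in>range of_int. a * b - 1 \<in> I 1"
    proof -
      have "\<not> int p dvd z" using p z(2) dvd_imp_le_int[of z "int p"] by auto
      then have "coprime z (int p)"
        using p(2) prime_imp_coprime[of "int p" z] by (simp add: coprime_commute)
      then obtain u v where uv: "u * z + v * int p = 1"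
        using bezout_int[of z "int p"] by (auto simp: coprime_iff_gcd_eq_1)
      then have "z * u - 1 = int p * (- v)" by (simp add: algebra_simps)
      then have "int p ^ 1 dvd z * u - 1" by simp
      then have "of_int (z * u - 1) \<in> I 1" unfolding I_iff .
      then show ?thesis using z by auto
    qed
    ultimately show "\<exists>I. adic_filtration (range of_int) I p \<and> (\<exists>b\<in>range of_int. a * b - 1 \<in> I 1)"
      by blast
  qed
qed

section \<open>Adjoining a transcendental element\<close>

text \<open>The generator \<open>t\<close> receives weight 1, so its i-th power contributes i to the
  filtration level; the subtraction \<open>s - i\<close> is truncated, and from degree
  \<open>s\<close> on every coefficient in \<open>R\<close> is allowed. Residues modulo
  \<open>I' 1\<close> are then those of constant terms, and separation follows coefficientwise
  because transcendence makes representing polynomials unique.\<close>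

lemma (in adic_filtration) adjoin_transcendental:
  assumes transc: "\<And>q. q \<in> polys_over R \<Longrightarrow> poly q t = 0 \<Longrightarrow> q = 0"
  defines "I' \<equiv> \<lambda>s. (\<lambda>q. poly q t) ` {q. \<forall>i. coeff q i \<in> I (s - i)}"
  shows "adic_filtration (adjoin R t) I' p"
proof (intro adic_filtration.intro adjoin_subring adic_filtration_axioms.intro)
  interpret P: subring_of "polys_over R" by (rule polys_over_subring)
  have I'I: "poly q t \<in> I' s" if "\<forall>i. coeff q i \<in> I (s - i)" for q s
    using that unfolding I'_def by blast
  show "I' 0 = adjoin R t" by (simp add: I'_def adjoin_def polys_over_def I_0)
  show "I' (Suc s) \<subseteq> I' s" for s
  proof -
    have "I (Suc s - i) \<subseteq> I (s - i)" for i by (rule I_antimono) simp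
    then show ?thesis unfolding I'_def by blast
  qed
  show "0 \<in> I' s" for s using I'I[of 0 s] by (simp add: I_zero)
  show "x + y \<in> I' s" if "x \<in> I' s" "y \<in> I' s" for x y s
  proof -
    from that obtain q r where "x = poly q t" "y = poly r t"
      "\<forall>i. coeff q i \<in> I (s - i)" "\<forall>i. coeff r i \<in> I (s - i)"
      by (auto simp: I'_def)
    then show ?thesis using I'I[of "q + r" s] by (simp add: I_add)
  qed
  show "x * y \<in> I' (s + u)" if "x \<in> I' s" "y \<in> I' u" for x y s u
  proof -
    from that obtain q r where *: "x = poly q t" "y = poly r t"
      "\<forall>i. coeff q i \<in> I (s - i)" "\<forall>i. coeff r i \<in> I (u - i)"
      by (auto simp: I'_def)
    have "coeff (q * r) i \<in> I (s + u - i)" for i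
      unfolding coeff_mult
    proof (rule I_sum)
      fix k assume "k \<in> {..i}"
      then have "s + u - i \<le> (s - k) + (u - (i - k))" by auto
      then show "coeff q k * coeff r (i - k) \<in> I (s + u - i)"
        using I_mult[of "coeff q k" "s - k" "coeff r (i - k)" "u - (i - k)"] * I_antimono by blast
    qed
    then show ?thesis using I'I[of "q * r" "s + u"] * by simp
  qed
  show "of_nat p \<in> I' 1"
    using I'I[of "[:of_nat p:]" 1] p_mem by (auto simp: coeff_pCons I_zero split: nat.splits)
  show "x = 0" if "\<And>s. x \<in> I' s" for x
  proof -
    have "\<exists>q. x = poly q t \<and> (\<forall>i. coeff q i \<in> I (s - i))" for s
      using that[of s] by (auto simp: I'_def)
    then obtain Q where Q: "\<And>s. x = poly (Q s) t" "\<And>s i. coeff (Q s) i \<in> I (s - i)" by metis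
    have QR: "Q s \<in> polys_over R" for s using Q(2) I_sub_R by (force simp: polys_over_def)
    have "Q s = Q 0" for s
      using transc[of "Q s - Q 0"] P.diff_mem[OF QR QR] Q(1)[of s] Q(1)[of 0] by simp
    then have "coeff (Q 0) i \<in> I s" for i s using Q(2)[of "s + i" i] by (metis add_diff_cancel_right')
    then have "coeff (Q 0) i = 0" for i by (rule I_separated)
    then have "Q 0 = 0" by (simp add: poly_eqI)
    then show ?thesis using Q(1)[of 0] by simp
  qed
  obtain T where T: "finite T" "T \<subseteq> R" "\<forall>x\<in>R. \<exists>t\<in>T. x - t \<in> I 1" using I_finite_index by blast
  show "\<exists>T. finite T \<and> T \<subseteq> adjoin R t \<and> (\<forall>x\<in>adjoin R t. \<exists>t\<in>T. x - t \<in> I' 1)"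
  proof (intro exI[of _ T] conjI ballI)
    show "T \<subseteq> adjoin R t" using T mem_adjoin by blast
    fix x assume "x \<in> adjoin R t"
    then obtain q where q: "x = poly q t" "q \<in> polys_over R" by (auto simp: adjoin_def)
    then have "coeff q 0 \<in> R" by (simp add: polys_over_def)
    then obtain c where c: "c \<in> T" "coeff q 0 - c \<in> I 1" using T by blast
    have "poly (q - [:c:]) t \<in> I' 1"
      using c q T by (intro I'I) (auto simp: coeff_pCons polys_over_def I_0 split: nat.splits)
    then show "\<exists>c\<in>T. x - c \<in> I' 1" using c q by auto
  qed (use T in auto)
qed

text \<open>With \<open>t\<close> of weight 1, an element is a unit modulo the first step as soon as
  its constant term is. A nonzero polynomial is nonzero at some natural number \<open>n\<close>, so
  expanding around \<open>n\<close>, that is, in powers of \<open>u = t - n\<close>, makes the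
  constant term nonzero, and the hypothesis on \<open>R\<close> applies to it.\<close>

lemma good_ring_adjoin_transcendental:
  fixes R :: "'a::{idom,ring_char_0} set"
  assumes R: "good_ring R"
    and transc: "\<And>q. q \<in> polys_over R \<Longrightarrow> poly q t = 0 \<Longrightarrow> q = 0"
  shows "good_ring (adjoin R t)"
proof -
  interpret subring_of R using R by (simp add: good_ring_def)
  interpret P: subring_of "polys_over R" by (rule polys_over_subring)
  show ?thesis unfolding good_ring_def
  proof (intro conjI adjoin_subring ballI impI)
    fix a assume "a \<in> adjoin R t" "a \<noteq> 0"
    then obtain q where q: "q \<in> polys_over R" "a = poly q t" by (auto simp: adjoin_def)
    with \<open>a \<noteq> 0\<close> have "q \<noteq> 0" by auto
    have "\<exists>n. poly q (of_nat n) \<noteq> 0"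
    proof (rule ccontr)
      assume "\<not> ?thesis"
      then have "range of_nat \<subseteq> {x. poly q x = 0}" by auto
      moreover have "infinite (range of_nat :: 'a set)"
        by (simp add: range_inj_infinite inj_on_def)
      ultimately show False using poly_roots_finite[OF \<open>q \<noteq> 0\<close>] finite_subset by blast
    qed
    then obtain n where n: "poly q (of_nat n) \<noteq> 0" by blast
    define u where "u = t - of_nat n"
    define r where "r = pcompose q [:of_nat n, 1:]"
    have rR: "r \<in> polys_over R"
      unfolding r_def by (intro pcompose_in_polys_over q linear_in_polys_over of_nat_mem)
    have ar: "a = poly r u" by (simp add: r_def u_def q poly_pcompose)
    have "coeff r 0 = poly q (of_nat n)"
      by (simp add: r_def poly_pcompose flip: poly_0_coeff_0)
    then have r0: "coeff r 0 \<noteq> 0" "coeff r 0 \<in> R"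
      using n rR unfolding polys_over_def by (simp, blast)
    have adj: "adjoin R t = adjoin R u" unfolding u_def using adjoin_shift[OF of_nat_mem] by simp
    have tu: "s = 0" if "s \<in> polys_over R" "poly s u = 0" for s
    proof -
      have "pcompose s [:- of_nat n, 1:] = 0"
        using that by (intro transc pcompose_in_polys_over linear_in_polys_over uminus_mem of_nat_mem)
          (simp_all add: poly_pcompose u_def)
      then show ?thesis using pcompose_eq_0[of s "[:- of_nat n, 1:]"] by simp
    qed
    obtain B where B: "\<forall>p>B. prime p \<longrightarrow>
        (\<exists>I. adic_filtration R I p \<and> (\<exists>b\<in>R. coeff r 0 * b - 1 \<in> I 1))"
      using R r0 unfolding good_ring_def by blast
    show "\<exists>B. \<forall>p>B. prime p \<longrightarrow>
      (\<exists>I. adic_filtration (adjoin R t) I p \<and> (\<exists>b\<in>adjoin R t. a * b - 1 \<in> I 1))"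
    proof (intro exI[of _ B] allI impI)
      fix p assume "p > B" "prime p"
      then obtain I b where I: "adic_filtration R I p" and b: "b \<in> R" "coeff r 0 * b - 1 \<in> I 1"
        using B by blast
      interpret adic_filtration R I p by (rule I)
      define I' where "I' = (\<lambda>s. (\<lambda>q. poly q u) ` {q. \<forall>i. coeff q i \<in> I (s - i)})"
      have "adic_filtration (adjoin R t) I' p"
        unfolding adj I'_def by (rule adjoin_transcendental) (rule tu)
      \<comment> \<open>For positive \<open>i\<close> the index \<open>1 - i\<close> is 0, so those
        coefficients only have to lie in \<open>R\<close>.\<close>
      moreover have "coeff (smult b r - 1) i \<in> I (1 - i)" for i
        using b rR by (cases i) (auto simp: coeff_1 polys_over_def I_0 mult.commute intro: mult_mem)
      then have "poly (smult b r - 1) u \<in> I' 1" unfolding I'_def by blast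
      then have "a * b - 1 \<in> I' 1" by (simp add: ar mult.commute)
      ultimately show "\<exists>I. adic_filtration (adjoin R t) I p \<and> (\<exists>b\<in>adjoin R t. a * b - 1 \<in> I 1)"
        using mem_adjoin[OF b(1)] by blast
    qed
  qed
qed


section \<open>Pseudo-division and adjoining an algebraic element\<close>

text \<open>Multiplying by the leading coefficient of \<open>f\<close> before each division step
  avoids inverting it. The set \<open>J\<close> plays an ideal of \<open>R\<close>: coefficients of
  the dividend in \<open>J\<close> stay in \<open>J\<close> throughout, which is how filtration
  levels are carried over to remainders.\<close>

lemma (in subring_of) pseudo_division:
  fixes f :: "'a poly"
  assumes f: "f \<in> polys_over R" "degree f > 0"
    and J: "0 \<in> J" "\<And>x y. x \<in> J \<Longrightarrow> y \<in> J \<Longrightarrow> x - y \<in> J" "\<And>c x. c \<in> R \<Longrightarrow> x \<in> J \<Longrightarrow> c * x \<in> J"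
      "J \<subseteq> R"
    and q: "q \<in> polys_over J"
  shows "\<exists>h s r. smult (lead_coeff f ^ h) q = s * f + r \<and> degree r < degree f \<and>
    s \<in> polys_over R \<and> r \<in> polys_over J"
  using q
proof (induction "degree q" arbitrary: q rule: less_induct)
  case less
  interpret P: subring_of "polys_over R" by (rule polys_over_subring)
  show ?case
  proof (cases "degree q < degree f")
    case True
    then show ?thesis using less.prems P.zero_mem
      by (intro exI[of _ 0] exI[of _ "0::'a poly"] exI[of _ q]) auto
  next
    case False
    define a where "a = lead_coeff f"
    define m where "m = monom (lead_coeff q) (degree q - degree f)"
    define q' where "q' = smult a q - m * f"
    have aR: "a \<in> R" using f by (simp add: a_def polys_over_def)
    have lq: "lead_coeff q \<in> J" using less.prems by (simp add: polys_over_def)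
    have m: "m \<in> polys_over R" using lq J zero_mem by (auto simp: m_def polys_over_def)
    have "coeff (m * f) i \<in> J" for i
    proof -
      have "coeff (m * f) i = (if i < degree q - degree f then 0
          else lead_coeff q * coeff f (i - (degree q - degree f)))"
        by (simp add: m_def coeff_monom_mult)
      then show ?thesis
        using J(1) J(3)[OF _ lq] f by (simp add: polys_over_def mult.commute[of "lead_coeff q"])
    qed
    then have q'J: "q' \<in> polys_over J"
      using less.prems J aR by (auto simp: q'_def polys_over_def)
    have "degree q' < degree q"
    proof -
      have "degree q' \<le> degree q"
        unfolding q'_def
      proof (rule degree_diff_le)
        show "degree (smult a q) \<le> degree q" by (rule degree_smult_le)
        have "degree (m * f) \<le> degree m + degree f" by (rule degree_mult_le)
        also have "degree m \<le> degree q - degree f" unfolding m_def by (rule degree_monom_le)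
        finally show "degree (m * f) \<le> degree q" using False by simp
      qed
      moreover have "coeff q' (degree q) = 0"
        using False by (simp add: q'_def m_def a_def coeff_monom_mult)
      moreover have "degree q > 0" using False f by simp
      ultimately show ?thesis
        by (metis coeff_0_degree_minus_1 degree_0 le_neq_implies_less leading_coeff_0_iff)
    qed
    from less.hyps[OF this q'J] obtain h s r where
      IH: "smult (a ^ h) q' = s * f + r" "degree r < degree f" "s \<in> polys_over R" "r \<in> polys_over J"
      unfolding a_def by blast
    have "smult (a ^ Suc h) q = smult (a ^ h) (q' + m * f)"
      by (simp add: q'_def mult.commute)
    also have "\<dots> = (s + smult (a ^ h) m) * f + r"
      by (simp add: IH(1) smult_add_right algebra_simps)
    finally show ?thesis
      using IH m P.add_mem[OF IH(3)] aR unfolding a_def[symmetric]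
      by (intro exI[of _ "Suc h"] exI[of _ "s + smult (a ^ h) m"] exI[of _ r])
         (auto simp: polys_over_def intro!: add_mem mult_mem power_mem)
  qed
qed

lemma (in subring_of) pseudo_division_ring:
  fixes f :: "'a poly"
  assumes "f \<in> polys_over R" "degree f > 0" "q \<in> polys_over R"
  shows "\<exists>h s r. smult (lead_coeff f ^ h) q = s * f + r \<and> degree r < degree f \<and>
    s \<in> polys_over R \<and> r \<in> polys_over R"
  by (rule pseudo_division[OF assms(1,2) _ _ _ _ assms(3)]) (auto intro: zero_mem diff_mem mult_mem)

text \<open>A relation of least degree stands in for a minimal polynomial; its leading coefficient
  need not be a unit of \<open>R\<close>.\<close>

locale minimal_relation = subring_of R for R :: "'a::idom set" +
  fixes t :: 'a and f :: "'a poly"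
  assumes f_over: "f \<in> polys_over R" and f_nonzero: "f \<noteq> 0" and f_root: "poly f t = 0"
    and f_minimal: "\<And>q. q \<in> polys_over R \<Longrightarrow> poly q t = 0 \<Longrightarrow> q \<noteq> 0 \<Longrightarrow> degree f \<le> degree q"
begin

lemma degree_f_pos: "degree f > 0"
proof (rule ccontr)
  assume "\<not> degree f > 0"
  then obtain c where "f = [:c:]" using degree_eq_zeroE by blast
  then show False using f_root f_nonzero by simp
qed

lemma lead_coeff_mem: "lead_coeff f \<in> R"
  using f_over by (simp add: polys_over_def)

lemma low_degree_zero: "q \<in> polys_over R \<Longrightarrow> poly q t = 0 \<Longrightarrow> degree q < degree f \<Longrightarrow> q = 0"
  using f_minimal by force

text \<open>Pseudo-dividing \<open>f\<close> by \<open>q\<close> and evaluating at \<open>t\<close>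
  gives \<open>r(t) = - s(t) q(t)\<close> with \<open>r\<close> of smaller degree than
  \<open>q\<close>. A multiplier for \<open>r(t)\<close> therefore yields one for
  \<open>q(t)\<close>, and the descent ends at a constant.\<close>

lemma low_degree_multiple_in_base:
  assumes "q \<in> polys_over R" "poly q t \<noteq> 0" "degree q < degree f"
  shows "\<exists>w\<in>adjoin R t. poly q t * w \<in> R \<and> poly q t * w \<noteq> 0"
  using assms
proof (induction "degree q" arbitrary: q rule: less_induct)
  case less
  show ?case
  proof (cases "degree q = 0")
    case True
    then obtain c where "q = [:c:]" using degree_eq_zeroE by blast
    then show ?thesis using less.prems const_in_polys_over
      by (intro bexI[of _ 1]) (auto intro: mem_adjoin one_mem)
  next
    case False
    then obtain h s r where
      d: "smult (lead_coeff q ^ h) f = s * q + r" "degree r < degree q"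
         "s \<in> polys_over R" "r \<in> polys_over R"
      using pseudo_division_ring[OF less.prems(1) _ f_over] by blast
    have eq: "poly r t = - (poly s t * poly q t)"
      using arg_cong[OF d(1), of "\<lambda>u. poly u t"] f_root by (simp add: eq_neg_iff_add_eq_0 add.commute)
    \<comment> \<open>Otherwise \<open>r = 0\<close> by minimality, so a nonzero multiple of
      \<open>f\<close> factors as \<open>s * q\<close> with \<open>s(t) = 0\<close>; since
      \<open>q\<close> is not constant, \<open>s\<close> would be a relation of degree smaller than
      that of \<open>f\<close>.\<close>
    have "poly r t \<noteq> 0"
    proof
      assume r0: "poly r t = 0"
      then have "r = 0" using low_degree_zero d less.prems by force
      have "poly s t = 0" using eq r0 less.prems by simp
      have q0: "q \<noteq> 0" using less.prems by auto
      have "smult (lead_coeff q ^ h) f \<noteq> 0" using q0 f_nonzero by simp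
      then have s0: "s \<noteq> 0" using d(1) \<open>r = 0\<close> by auto
      have "degree f = degree s + degree q"
        using arg_cong[OF d(1), of degree] q0 s0 \<open>r = 0\<close> by (simp add: degree_mult_eq)
      then show False using f_minimal[OF d(3) \<open>poly s t = 0\<close> s0] False by simp
    qed
    then obtain w where w: "w \<in> adjoin R t" "poly r t * w \<in> R" "poly r t * w \<noteq> 0"
      using less.hyps[of r] d less.prems by fastforce
    interpret A: subring_of "adjoin R t" by (rule adjoin_subring)
    have "- poly s t * w \<in> adjoin R t"
      using w d by (intro A.mult_mem A.uminus_mem) (auto simp: adjoin_def)
    moreover have "poly q t * (- poly s t * w) = poly r t * w" by (simp add: eq)
    ultimately show ?thesis using w by metis
  qed
qed

text \<open>Questions about nonzero elements of \<open>adjoin R t\<close>, namely separation and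
  invertibility modulo the filtration, are pushed down to \<open>R\<close> by this
  multiplication.\<close>

lemma multiple_in_base:
  assumes "u \<in> adjoin R t" "u \<noteq> 0"
  shows "\<exists>w\<in>adjoin R t. u * w \<in> R \<and> u * w \<noteq> 0"
proof -
  obtain q where q: "q \<in> polys_over R" "u = poly q t" using assms by (auto simp: adjoin_def)
  obtain h s r where d: "smult (lead_coeff f ^ h) q = s * f + r" "degree r < degree f"
    "s \<in> polys_over R" "r \<in> polys_over R"
    using pseudo_division_ring[OF f_over degree_f_pos q(1)] by blast
  have eq: "lead_coeff f ^ h * u = poly r t"
    using arg_cong[OF d(1), of "\<lambda>u. poly u t"] f_root q by simp
  then have "poly r t \<noteq> 0" using assms f_nonzero by auto
  then obtain w where w: "w \<in> adjoin R t" "poly r t * w \<in> R" "poly r t * w \<noteq> 0"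
    using low_degree_multiple_in_base d by blast
  interpret A: subring_of "adjoin R t" by (rule adjoin_subring)
  have "lead_coeff f ^ h * w \<in> adjoin R t"
    by (intro A.mult_mem[OF _ w(1)] mem_adjoin power_mem lead_coeff_mem)
  moreover have "u * (lead_coeff f ^ h * w) = poly r t * w" by (simp flip: eq)
  ultimately show ?thesis using w by metis
qed

end

lemma finite_bounded_coeffs: 
  assumes "finite T"
  shows "finite {q :: 'a::zero poly. degree q \<le> n \<and> (\<forall>i\<le>n. coeff q i \<in> T)}"
proof (rule finite_subset)
  show "{q :: 'a poly. degree q \<le> n \<and> (\<forall>i\<le>n. coeff q i \<in> T)} \<subseteq> Poly ` {xs. set xs \<subseteq> T \<and> length xs = Suc n}"
  proof
    fix q :: "'a poly" assume q: "q \<in> {q. degree q \<le> n \<and> (\<forall>i\<le>n. coeff q i \<in> T)}"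
    define xs where "xs = map (coeff q) [0..<Suc n]"
    have "q = Poly xs"
      using q by (intro poly_eqI) (auto simp: xs_def nth_default_def coeff_eq_0 simp del: upt_Suc)
    moreover have "set xs \<subseteq> T" using q by (auto simp: xs_def)
    ultimately show "q \<in> Poly ` {xs. set xs \<subseteq> T \<and> length xs = Suc n}" by (auto simp: xs_def)
  qed
  show "finite (Poly ` {xs. set xs \<subseteq> T \<and> length xs = Suc n})"
    using finite_lists_length_eq[OF assms] by blast
qed

locale adic_minimal_relation = minimal_relation R t f + adic_filtration R I p
  for R :: "'a::idom set" and t f I p +
  fixes b :: 'a
  assumes b_mem: "b \<in> R" and b_inverse: "lead_coeff f * b - 1 \<in> I 1"
begin

lemma reduce:
  assumes "q \<in> polys_over (I s)"
  shows "\<exists>h r. lead_coeff f ^ h * poly q t = poly r t \<and> degree r < degree f \<and> r \<in> polys_over (I s)"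
proof -
  obtain h u r where d: "smult (lead_coeff f ^ h) q = u * f + r" "degree r < degree f"
    "r \<in> polys_over (I s)"
    using pseudo_division[OF f_over degree_f_pos I_zero I_diff I_scale I_sub_R assms] by blast
  have "lead_coeff f ^ h * poly q t = poly r t"
    using arg_cong[OF d(1), of "\<lambda>u. poly u t"] f_root by simp
  then show ?thesis using d by blast
qed

text \<open>After multiplication by a power of the leading coefficient, \<open>c\<close> is
  represented by some \<open>r\<close> over \<open>I s\<close> of degree below
  \<open>degree f\<close>. By minimality \<open>r\<close> is the constant it represents, so that
  constant is in \<open>I s\<close>; \<open>unit_cancel\<close> then removes the power.\<close>

lemma base_inter:
  assumes c: "c \<in> R" "c = poly q t" "q \<in> polys_over (I s)"
  shows "c \<in> I s"
proof -
  obtain h r where r: "lead_coeff f ^ h * c = poly r t" "degree r < degree f" "r \<in> polys_over (I s)"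
    using reduce[OF c(3)] c(2) by blast
  interpret P: subring_of "polys_over R" by (rule polys_over_subring)
  define e where "e = lead_coeff f ^ h * c"
  have "e \<in> R" using c lead_coeff_mem by (simp add: e_def mult_mem power_mem)
  have "r \<in> polys_over R" using r I_sub_R by (auto simp: polys_over_def)
  then have "r - [:e:] = 0"
    using r degree_f_pos \<open>e \<in> R\<close>
    by (intro low_degree_zero P.diff_mem) (auto simp: e_def const_in_polys_over degree_diff_less)
  then have "e = coeff r 0" by (metis coeff_pCons_0 eq_iff_diff_eq_0)
  then have "e \<in> I s" using r by (simp add: polys_over_def)
  then show ?thesis using unit_cancel[OF lead_coeff_mem b_mem b_inverse c(1)] unfolding e_def by blast
qed

text \<open>This is the ideal of \<open>adjoin R t\<close> generated by \<open>I s\<close>.\<close>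

definition ext_filtration :: "nat \<Rightarrow> 'a set" where
  "ext_filtration s = (\<lambda>q. poly q t) ` polys_over (I s)"

lemma ext_filtrationI: "q \<in> polys_over (I s) \<Longrightarrow> poly q t \<in> ext_filtration s"
  by (auto simp: ext_filtration_def)

lemma ext_add: "x \<in> ext_filtration s \<Longrightarrow> y \<in> ext_filtration s \<Longrightarrow> x + y \<in> ext_filtration s"
proof -
  assume "x \<in> ext_filtration s" "y \<in> ext_filtration s"
  then obtain q r where "x = poly q t" "y = poly r t" "q \<in> polys_over (I s)" "r \<in> polys_over (I s)"
    by (auto simp: ext_filtration_def)
  then show ?thesis using ext_filtrationI[of "q + r" s] by (auto simp: polys_over_def I_add)
qed

lemma ext_mult: "x \<in> ext_filtration s \<Longrightarrow> y \<in> ext_filtration u \<Longrightarrow> x * y \<in> ext_filtration (s + u)"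
proof -
  assume "x \<in> ext_filtration s" "y \<in> ext_filtration u"
  then obtain q r where "x = poly q t" "y = poly r t" "q \<in> polys_over (I s)" "r \<in> polys_over (I u)"
    by (auto simp: ext_filtration_def)
  then show ?thesis using ext_filtrationI[of "q * r" "s + u"]
    by (auto simp: polys_over_def coeff_mult intro!: I_sum I_mult)
qed

lemma ext_const: "c \<in> I s \<Longrightarrow> c \<in> ext_filtration s"
  using ext_filtrationI[of "[:c:]" s] I_zero[of s]
  by (auto simp: polys_over_def coeff_pCons split: nat.splits)

lemma ext_0: "ext_filtration 0 = adjoin R t"
  by (simp add: ext_filtration_def adjoin_def I_0)

text \<open>Pseudo-division represents a power of the leading coefficient times the element;
  multiplying by the same power of \<open>b\<close> undoes this modulo the first step.\<close>

lemma reduce_mod: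
  assumes "q \<in> polys_over R"
  shows "\<exists>r\<in>polys_over R. degree r < degree f \<and> poly q t - poly r t \<in> ext_filtration 1"
proof -
  obtain h r where r: "lead_coeff f ^ h * poly q t = poly r t" "degree r < degree f" "r \<in> polys_over R"
    using reduce[of q 0] assms I_0 by auto
  have unit: "(b * lead_coeff f) ^ h - 1 \<in> I 1"
  proof (induction h)
    case (Suc h)
    have "(b * lead_coeff f) ^ Suc h - 1 = b * lead_coeff f * ((b * lead_coeff f) ^ h - 1) + (lead_coeff f * b - 1)"
      by (simp add: algebra_simps)
    also have "\<dots> \<in> I 1"
      using Suc b_inverse b_mem lead_coeff_mem by (intro I_add I_scale mult_mem)
    finally show ?case .
  qed (simp add: I_zero)
  have "poly q t - poly (smult (b ^ h) r) t = - ((b * lead_coeff f) ^ h - 1) * poly q t"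
    by (simp add: algebra_simps flip: r(1))
  also have "\<dots> \<in> ext_filtration (1 + 0)"
    using ext_0 assms by (intro ext_mult[OF ext_const[OF I_uminus[OF unit]]]) (auto simp: adjoin_def)
  finally have "poly q t - poly (smult (b ^ h) r) t \<in> ext_filtration 1" by simp
  moreover have "smult (b ^ h) r \<in> polys_over R"
    using r b_mem by (auto simp: polys_over_def intro: mult_mem power_mem)
  moreover have "degree (smult (b ^ h) r) < degree f" using r(2) degree_smult_le le_less_trans by blast
  ultimately show ?thesis by blast
qed

text \<open>A nonzero element in every step would have a nonzero multiple in \<open>R\<close>, which
  by \<open>base_inter\<close> lies in every \<open>I s\<close>. The finite residue system consists
  of the values at \<open>t\<close> of polynomials of degree below \<open>degree f\<close> with
  coefficients in a residue system of \<open>R\<close>.\<close>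

lemma adic_filtration_ext: "adic_filtration (adjoin R t) ext_filtration p"
proof (intro adic_filtration.intro adjoin_subring adic_filtration_axioms.intro ext_0 ext_add ext_mult)
  show "ext_filtration (Suc s) \<subseteq> ext_filtration s" for s
    using I_Suc[of s] unfolding ext_filtration_def polys_over_def by blast
  show "0 \<in> ext_filtration s" for s by (rule ext_const[OF I_zero])
  show "of_nat p \<in> ext_filtration 1" by (rule ext_const[OF p_mem])
  show "x = 0" if x: "\<And>s. x \<in> ext_filtration s" for x
  proof (rule ccontr)
    assume "x \<noteq> 0"
    moreover have "x \<in> adjoin R t" using x[of 0] ext_0 by simp
    ultimately obtain w where w: "w \<in> adjoin R t" "x * w \<in> R" "x * w \<noteq> 0"
      using multiple_in_base by blast
    have "x * w \<in> I s" for s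
    proof -
      have "x * w \<in> ext_filtration (s + 0)" using x[of s] w ext_0 by (intro ext_mult) auto
      then show ?thesis using base_inter[OF w(2)] by (auto simp: ext_filtration_def)
    qed
    then show False using I_separated w(3) by blast
  qed
  obtain T where T: "finite T" "T \<subseteq> R" "\<forall>x\<in>R. \<exists>t\<in>T. x - t \<in> I 1" using I_finite_index by blast
  obtain \<tau> where \<tau>: "\<And>x. x \<in> R \<Longrightarrow> \<tau> x \<in> T" "\<And>x. x \<in> R \<Longrightarrow> x - \<tau> x \<in> I 1" using T(3) by metis
  define n where "n = degree f - 1"
  define Q where "Q = {q. degree q \<le> n \<and> (\<forall>i\<le>n. coeff q i \<in> T)}"
  show "\<exists>T. finite T \<and> T \<subseteq> adjoin R t \<and> (\<forall>x\<in>adjoin R t. \<exists>u\<in>T. x - u \<in> ext_filtration 1)"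
  proof (intro exI[of _ "(\<lambda>q. poly q t) ` Q"] conjI ballI)
    show "finite ((\<lambda>q. poly q t) ` Q)" unfolding Q_def using finite_bounded_coeffs[OF T(1)] by blast
    have "coeff q i \<in> R" if "q \<in> Q" for q i
      using that T(2) zero_mem by (cases "i \<le> n") (auto simp: Q_def coeff_eq_0)
    then show "(\<lambda>q. poly q t) ` Q \<subseteq> adjoin R t" by (auto simp: adjoin_def polys_over_def)
    fix x assume "x \<in> adjoin R t"
    then obtain r where r: "r \<in> polys_over R" "degree r < degree f" "x - poly r t \<in> ext_filtration 1"
      using reduce_mod by (auto simp: adjoin_def)
    define u where "u = (\<Sum>i\<le>n. monom (\<tau> (coeff r i)) i)"
    have cu: "coeff u i = (if i \<le> n then \<tau> (coeff r i) else 0)" for i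
      by (simp add: u_def coeff_sum)
    have "coeff r i = 0" if "\<not> i \<le> n" for i using that r by (intro coeff_eq_0) (simp add: n_def)
    then have "r - u \<in> polys_over (I 1)"
      using \<tau>(2) r(1) I_zero by (auto simp: polys_over_def cu)
    from ext_add[OF r(3) ext_filtrationI[OF this]] have "x - poly u t \<in> ext_filtration 1" by simp
    moreover have "u \<in> Q"
      using \<tau>(1) r(1) by (auto simp: Q_def cu polys_over_def intro!: degree_le)
    ultimately show "\<exists>u\<in>(\<lambda>q. poly q t) ` Q. x - u \<in> ext_filtration 1" by blast
  qed
qed

end

lemma good_ring_adjoin_algebraic:
  fixes R :: "'a::idom set"
  assumes R: "good_ring R" and alg: "q \<in> polys_over R" "q \<noteq> 0" "poly q t = 0"
  shows "good_ring (adjoin R t)"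
proof -
  interpret subring_of R using R by (simp add: good_ring_def)
  interpret A: subring_of "adjoin R t" by (rule adjoin_subring)
  obtain f where f: "f \<in> polys_over R \<and> f \<noteq> 0 \<and> poly f t = 0"
    "\<And>q. q \<in> polys_over R \<and> q \<noteq> 0 \<and> poly q t = 0 \<Longrightarrow> degree f \<le> degree q"
    using ex_has_least_nat[of "\<lambda>q. q \<in> polys_over R \<and> q \<noteq> 0 \<and> poly q t = 0" q degree] alg by blast
  interpret minimal_relation R t f using f by unfold_locales auto
  show ?thesis unfolding good_ring_def
  proof (intro conjI adjoin_subring ballI impI)
    fix a assume a: "a \<in> adjoin R t" "a \<noteq> 0"
    then obtain w where w: "w \<in> adjoin R t" "a * w \<in> R" "a * w \<noteq> 0" using multiple_in_base by blast
    \<comment> \<open>Inverting this single product modulo the filtration serves twice: it inverts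
      the leading coefficient, as the extension of the filtration requires, and it inverts
      \<open>a\<close> itself.\<close>
    have "lead_coeff f * (a * w) \<in> R" "lead_coeff f * (a * w) \<noteq> 0"
      using w lead_coeff_mem f_nonzero by (auto intro: mult_mem)
    then obtain B where B: "\<forall>p>B. prime p \<longrightarrow>
        (\<exists>I. adic_filtration R I p \<and> (\<exists>b\<in>R. lead_coeff f * (a * w) * b - 1 \<in> I 1))"
      using R unfolding good_ring_def by blast
    show "\<exists>B. \<forall>p>B. prime p \<longrightarrow>
      (\<exists>I. adic_filtration (adjoin R t) I p \<and> (\<exists>b\<in>adjoin R t. a * b - 1 \<in> I 1))"
    proof (intro exI[of _ B] allI impI)
      fix p assume "p > B" "prime p"
      then obtain I b where I: "adic_filtration R I p" and b: "b \<in> R" "lead_coeff f * (a * w) * b - 1 \<in> I 1"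
        using B by blast
      interpret adic_filtration R I p by (rule I)
      interpret adic_minimal_relation R t f I p "a * w * b"
      proof
        show "a * w * b \<in> R" using w(2) b(1) by (rule mult_mem)
        show "lead_coeff f * (a * w * b) - 1 \<in> I 1" using b(2) by (simp only: mult.assoc)
      qed
      have "a * (w * lead_coeff f * b) - 1 \<in> ext_filtration 1"
        using ext_const[OF b(2)] by (simp add: algebra_simps)
      moreover have "w * lead_coeff f * b \<in> adjoin R t"
        using w b lead_coeff_mem by (intro A.mult_mem) (auto intro: mem_adjoin)
      ultimately show "\<exists>I. adic_filtration (adjoin R t) I p \<and> (\<exists>b\<in>adjoin R t. a * b - 1 \<in> I 1)"
        using adic_filtration_ext by blast
    qed
  qed
qed

text \<open>Each new generator is either algebraic or transcendental over the ring already built,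
  starting from the integers.\<close>

lemma finite_subset_good_ring:
  fixes X :: "'a::{idom,ring_char_0} set"
  assumes "finite X"
  shows "\<exists>R. good_ring R \<and> X \<subseteq> R"
  using assms
proof (induction X rule: finite_induct)
  case empty
  show ?case using good_ring_int by blast
next
  case (insert t X)
  then obtain R where R: "good_ring R" "X \<subseteq> R" by blast
  interpret subring_of R using R by (simp add: good_ring_def)
  have "good_ring (adjoin R t)"
    using good_ring_adjoin_transcendental[OF R(1)] good_ring_adjoin_algebraic[OF R(1)] by blast
  then show ?case using R(2) mem_adjoin generator_mem_adjoin by blast
qed

section \<open>Periods of matrix cocycles modulo a filtration\<close>

text \<open>This provides the assumption \<open>A_shift\<close> for matrices whose entries are
  values of polynomials over \<open>R\<close>.\<close>

lemma (in subring_of) poly_diff_scale: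
  assumes "q \<in> polys_over R" "x \<in> R" "d \<in> R"
  shows "\<exists>c\<in>R. poly q (x + d) - poly q x = c * d"
  using assms(1)
proof (induction q)
  case (pCons a q)
  then have q: "q \<in> polys_over R" by (simp add: polys_over_pCons)
  then obtain c where c: "c \<in> R" "poly q (x + d) - poly q x = c * d" using pCons.IH by blast
  have "poly (pCons a q) (x + d) - poly (pCons a q) x
      = d * poly q (x + d) + x * (poly q (x + d) - poly q x)"
    by (simp add: algebra_simps)
  also have "\<dots> = (poly q (x + d) + x * c) * d" unfolding c(2) by (simp add: algebra_simps)
  finally show ?case using c assms q by (blast intro: add_mem mult_mem poly_mem)
qed (auto intro: bexI[of _ 0] zero_mem)

primrec cocycle_prod :: "(nat \<Rightarrow> 'a::semiring_1 ^ 'n ^ 'n) \<Rightarrow> nat \<Rightarrow> nat \<Rightarrow> 'a ^ 'n ^ 'n" where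
  "cocycle_prod A x 0 = mat 1"
| "cocycle_prod A x (Suc r) = A (x + r) ** cocycle_prod A x r"

lemma cocycle_prod_add:
  "cocycle_prod A x (r + t) = cocycle_prod A (x + r) t ** cocycle_prod A x r"
  by (induction t) (simp_all add: matrix_mul_assoc add.assoc)

definition (in subring_of) mat_over :: "'a ^ 'n ^ 'n \<Rightarrow> bool" where
  "mat_over X \<longleftrightarrow> (\<forall>i j. X $ i $ j \<in> R)"

definition (in adic_filtration) mat_cong :: "nat \<Rightarrow> 'a ^ 'n ^ 'n \<Rightarrow> 'a ^ 'n ^ 'n \<Rightarrow> bool" where
  "mat_cong s X Y \<longleftrightarrow> (\<forall>i j. X $ i $ j - Y $ i $ j \<in> I s)"

lemma (in subring_of) mat_over_1: "mat_over (mat 1)"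
  by (auto simp: mat_over_def mat_def one_mem zero_mem)

lemma (in subring_of) mat_over_mult: "mat_over X \<Longrightarrow> mat_over Y \<Longrightarrow> mat_over (X ** Y)"
  by (auto simp: mat_over_def matrix_matrix_mult_def intro!: sum_mem mult_mem)

context adic_filtration
begin

lemma mat_cong_refl: "mat_cong s X X"
  by (simp add: mat_cong_def I_zero)

lemma mat_cong_sym: "mat_cong s X Y \<Longrightarrow> mat_cong s Y X"
  unfolding mat_cong_def by (metis I_uminus minus_diff_eq)

lemma mat_cong_trans: "mat_cong s X Y \<Longrightarrow> mat_cong s Y Z \<Longrightarrow> mat_cong s X Z"
  unfolding mat_cong_def by (metis I_add diff_add_cancel add_diff_eq)

lemma mat_cong_mult:
  assumes "mat_cong s X X'" "mat_cong s Y Y'" "mat_over X'" "mat_over Y"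
  shows "mat_cong s (X ** Y) (X' ** Y')"
  unfolding mat_cong_def
proof (intro allI)
  fix i j
  have "(X ** Y) $ i $ j - (X' ** Y') $ i $ j =
    (\<Sum>k\<in>UNIV. (X $ i $ k - X' $ i $ k) * Y $ k $ j + X' $ i $ k * (Y $ k $ j - Y' $ k $ j))"
    by (simp add: matrix_matrix_mult_def algebra_simps flip: sum_subtractf sum.distrib)
  also have "\<dots> \<in> I s"
    using assms by (intro I_sum I_add I_scale I_scale_right) (auto simp: mat_cong_def mat_over_def)
  finally show "(X ** Y) $ i $ j - (X' ** Y') $ i $ j \<in> I s" .
qed

lemma mat_cong_cancel_right:
  assumes "mat_cong s (X ** Z) (Y ** Z)" "Z ** W = mat 1" "mat_over W" "mat_over Z" "mat_over Y"
  shows "mat_cong s X Y"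
proof -
  have "mat_cong s ((X ** Z) ** W) ((Y ** Z) ** W)"
    by (rule mat_cong_mult[OF assms(1) mat_cong_refl mat_over_mult[OF assms(5,4)] assms(3)])
  then show ?thesis using assms(2) by (simp flip: matrix_mul_assoc)
qed

end

section \<open>Trivial lengths modulo each step of the filtration\<close>

locale adic_cocycle = adic_filtration R I p for R :: "'a::comm_ring_1 set" and I p +
  fixes A B :: "nat \<Rightarrow> 'a ^ 'n ^ 'n"
  assumes A_over: "mat_over (A x)" and B_over: "mat_over (B x)" and A_B: "A x ** B x = mat 1"
    and A_shift: "of_nat d \<in> I s \<Longrightarrow> mat_cong s (A (x + d)) (A x)"
    and p_prime: "prime p"
begin

abbreviation "M \<equiv> cocycle_prod A"

lemma M_over: "mat_over (M x r)"
  by (induction r) (auto intro: mat_over_1 mat_over_mult A_over)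

lemma M_right_inverse: "\<exists>W. mat_over W \<and> M x r ** W = mat 1"
proof (induction r)
  case 0
  show ?case using mat_over_1 by (intro exI[of _ "mat 1"]) auto
next
  case (Suc r)
  then obtain W where W: "mat_over W" "M x r ** W = mat 1" by blast
  have "M x (Suc r) ** (W ** B (x + r)) = A (x + r) ** (M x r ** W) ** B (x + r)"
    by (simp add: matrix_mul_assoc)
  then show ?case using W A_B B_over mat_over_mult by (intro exI[of _ "W ** B (x + r)"]) auto
qed

lemma M_shift:
  assumes "of_nat d \<in> I s"
  shows "mat_cong s (M (x + d) r) (M x r)"
proof (induction r)
  case (Suc r)
  have "mat_cong s (A (x + r + d)) (A (x + r))" using A_shift assms by blast
  then show ?case using Suc M_over A_over
    by (auto intro!: mat_cong_mult simp: ac_simps)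
qed (simp add: mat_cong_refl)

lemma M_multiple:
  assumes "\<And>x. mat_cong s (M x L) (mat 1)"
  shows "mat_cong s (M x (k * L)) (mat 1)"
proof (induction k)
  case (Suc k)
  have "mat_cong s (M (x + k * L) L ** M x (k * L)) (mat 1 ** mat 1)"
    by (intro mat_cong_mult assms Suc M_over mat_over_1)
  then show ?case using cocycle_prod_add[of A x "k * L" L] by (simp add: add.commute)
qed (simp add: mat_cong_refl)

lemma of_nat_multiple: "of_nat d \<in> I s \<Longrightarrow> of_nat (k * d) \<in> I s"
  using I_scale[OF of_nat_mem] by simp

text \<open>Pigeonhole over the finite residue ring. Lengths are multiples of \<open>p * p\<close>,
  so that they lie in \<open>I 2\<close>: the first use of \<open>lift_period\<close>, from level 1
  to level 2, needs this.\<close>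

lemma residual_period: "\<exists>m>0. of_nat m \<in> I 2 \<and> (\<forall>x. mat_cong 1 (M x m) (mat 1))"
proof -
  have p2: "of_nat (p * p) \<in> I 2" using I_mult[OF p_mem p_mem] by (simp add: numeral_2_eq_2)
  define q where "q = p * p"
  have q0: "q > 0" using p_prime by (simp add: q_def prime_gt_0_nat)
  have q1: "of_nat (k * q) \<in> I 1" for k
    using of_nat_multiple[OF p2] I_antimono[of 1 2] unfolding q_def by auto
  obtain T where T: "finite T" "T \<subseteq> R" "\<forall>x\<in>R. \<exists>t\<in>T. x - t \<in> I 1" using I_finite_index by blast
  obtain \<tau> where \<tau>: "\<And>x. x \<in> R \<Longrightarrow> \<tau> x \<in> T" "\<And>x. x \<in> R \<Longrightarrow> x - \<tau> x \<in> I 1" using T(3) by metis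
  \<comment> \<open>\<open>F k\<close> records the entries of \<open>M 0 (k * q)\<close> modulo
    \<open>I 1\<close>, so it takes finitely many values.\<close>
  define F where "F k = (\<lambda>z. \<tau> (M 0 (k * q) $ fst z $ snd z))" for k
  have "range F \<subseteq> PiE UNIV (\<lambda>_. T)"
    using \<tau>(1) M_over by (auto simp: F_def mat_over_def)
  moreover have "finite (PiE (UNIV :: ('n \<times> 'n) set) (\<lambda>_. T))" using T by (intro finite_PiE) auto
  ultimately have "finite (range F)" by (rule finite_subset)
  then have "\<not> inj F" using finite_imageD infinite_UNIV_nat by blast
  then obtain i k where ik: "i < k" "F i = F k" unfolding inj_def by (metis linorder_neqE_nat)
  have "mat_cong 1 (M 0 (k * q)) (M 0 (i * q))"
    unfolding mat_cong_def
  proof (intro allI)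
    fix a b
    have eq: "\<tau> (M 0 (i * q) $ a $ b) = \<tau> (M 0 (k * q) $ a $ b)"
      using fun_cong[OF ik(2), of "(a, b)"] by (simp add: F_def)
    have "(M 0 (k * q) $ a $ b - \<tau> (M 0 (k * q) $ a $ b)) - (M 0 (i * q) $ a $ b - \<tau> (M 0 (i * q) $ a $ b)) \<in> I 1"
      using \<tau>(2) M_over by (intro I_diff[OF \<tau>(2) \<tau>(2)]) (auto simp: mat_over_def)
    then show "M 0 (k * q) $ a $ b - M 0 (i * q) $ a $ b \<in> I 1" by (simp add: eq)
  qed
  define m where "m = (k - i) * q"
  have kq: "k * q = i * q + m" using ik(1) by (simp add: m_def flip: distrib_right)
  \<comment> \<open>The starting point \<open>i * q\<close> is in \<open>I 1\<close>, so modulo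
    \<open>I 1\<close> it may be replaced by 0; the common right factor is cancelled
    afterwards.\<close>
  have "mat_cong 1 (M 0 m ** M 0 (i * q)) (M (0 + i * q) m ** M 0 (i * q))"
    by (intro mat_cong_mult mat_cong_refl M_over mat_cong_sym[OF M_shift] q1)
  then have "mat_cong 1 (M 0 m ** M 0 (i * q)) (mat 1 ** M 0 (i * q))"
    using \<open>mat_cong 1 (M 0 (k * q)) (M 0 (i * q))\<close> mat_cong_trans
    by (simp add: kq cocycle_prod_add) blast
  moreover obtain W where "mat_over W" "M 0 (i * q) ** W = mat 1" using M_right_inverse by blast
  ultimately have M0: "mat_cong 1 (M 0 m) (mat 1)"
    using mat_cong_cancel_right M_over mat_over_1 by blast
  \<comment> \<open>The product of length \<open>x + m\<close> from 0 is split in two ways, after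
    \<open>x\<close> and after \<open>m\<close> factors, to transport triviality from 0 to
    \<open>x\<close>.\<close>
  have "mat_cong 1 (M x m) (mat 1)" for x
  proof -
    have "M x m ** M 0 x = M m x ** M 0 m"
      using cocycle_prod_add[of A 0 x m] cocycle_prod_add[of A 0 m x] by (simp add: add.commute)
    moreover have "mat_cong 1 (M (0 + m) x ** M 0 m) (M 0 x ** mat 1)"
      unfolding m_def by (intro mat_cong_mult M_shift q1 M_over M0[unfolded m_def])
    ultimately have "mat_cong 1 (M x m ** M 0 x) (mat 1 ** M 0 x)" by simp
    moreover obtain W where "mat_over W" "M 0 x ** W = mat 1" using M_right_inverse by blast
    ultimately show ?thesis using mat_cong_cancel_right M_over mat_over_1 by blast
  qed
  moreover have "of_nat m \<in> I 2" using of_nat_multiple[OF p2] by (simp add: m_def q_def)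
  moreover have "m > 0" using ik(1) q0 by (simp add: m_def)
  ultimately show ?thesis by blast
qed

text \<open>If \<open>M x L = 1 + E\<close> with \<open>E \<equiv> 0\<close> modulo \<open>I s\<close>, then \<open>M x (p L) \<equiv> (1 + E)\<^sup>p \<equiv> 1 + p E\<close>
  modulo \<open>I (s + 1)\<close>; the first congruence needs \<open>L \<in> I (s + 1)\<close>.\<close>

lemma lift_period:
  assumes L: "of_nat L \<in> I (Suc s)" and s: "s \<ge> 1" and M: "\<And>x. mat_cong s (M x L) (mat 1)"
  shows "mat_cong (Suc s) (M x (p * L)) (mat 1)"
proof -
  define e where "e i j = M x L $ i $ j - mat 1 $ i $ j" for i j
  have e: "e i j \<in> I s" for i j using M by (simp add: e_def mat_cong_def)
  have eR: "e i j \<in> R" for i j using e I_sub_R by blast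
  define F where "F k = (\<chi> i j. mat 1 $ i $ j + of_nat k * e i j)" for k :: nat
  have F_over: "mat_over (F k)" for k
    using eR mat_over_1 by (auto simp: mat_over_def F_def intro!: add_mem mult_mem of_nat_mem)
  have FF: "mat_cong (Suc s) (F k ** F 1) (F (Suc k))" for k
    unfolding mat_cong_def
  proof (intro allI)
    fix i j
    have "(F k ** F 1) $ i $ j = (\<Sum>l\<in>UNIV. mat 1 $ i $ l * mat 1 $ l $ j)
        + (\<Sum>l\<in>UNIV. mat 1 $ i $ l * e l j) + of_nat k * (\<Sum>l\<in>UNIV. e i l * mat 1 $ l $ j)
        + of_nat k * (\<Sum>l\<in>UNIV. e i l * e l j)"
      by (simp add: F_def matrix_matrix_mult_def algebra_simps sum.distrib sum_distrib_left)
    also have "(\<Sum>l\<in>UNIV. mat 1 $ i $ l * mat 1 $ l $ j) = (mat 1 $ i $ j :: 'a)"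
      using arg_cong[OF matrix_mul_lid[of "mat 1 :: 'a ^ 'n ^ 'n"], of "\<lambda>X. X $ i $ j"]
      by (simp add: matrix_matrix_mult_def)
    also have "(\<Sum>l\<in>UNIV. mat 1 $ i $ l * e l j) = e i j"
      by (simp add: mat_def if_distrib[of "\<lambda>x. x * _"] cong: if_cong)
    also have "(\<Sum>l\<in>UNIV. e i l * mat 1 $ l $ j) = e i j"
      by (simp add: mat_def if_distrib[of "\<lambda>x. _ * x"] cong: if_cong)
    finally have "(F k ** F 1) $ i $ j - F (Suc k) $ i $ j = of_nat k * (\<Sum>l\<in>UNIV. e i l * e l j)"
      by (simp add: F_def algebra_simps)
    \<comment> \<open>The quadratic error lies in \<open>I (s + s)\<close>, which is inside
      \<open>I (Suc s)\<close> because \<open>s \<ge> 1\<close>.\<close>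
    moreover have "e i l * e l j \<in> I (Suc s)" for l
      using I_mult[OF e e] I_antimono[of "Suc s" "s + s"] s by force
    then have "of_nat k * (\<Sum>l\<in>UNIV. e i l * e l j) \<in> I (Suc s)"
      by (intro I_scale[OF of_nat_mem I_sum])
    ultimately show "(F k ** F 1) $ i $ j - F (Suc k) $ i $ j \<in> I (Suc s)" by simp
  qed
  have M_L: "M x L = F 1" by (simp add: F_def e_def vec_eq_iff)
  have "mat_cong (Suc s) (M x (k * L)) (F k)" for k
  proof (induction k)
    case 0
    have "F 0 = mat 1" by (simp add: F_def vec_eq_iff)
    then show ?case by (simp add: mat_cong_refl)
  next
    case (Suc k)
    have "mat_cong (Suc s) (M (x + L) (k * L) ** M x L) (F k ** F 1)"
      using mat_cong_trans[OF M_shift[OF L] Suc] M_over F_over M_L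
      by (intro mat_cong_mult) (auto simp: mat_cong_refl)
    moreover have "M x (Suc k * L) = M (x + L) (k * L) ** M x L"
      using cocycle_prod_add[of A x L "k * L"] by simp
    ultimately show ?case using FF mat_cong_trans by metis
  qed
  moreover have "of_nat p * e i j \<in> I (Suc s)" for i j using I_mult[OF p_mem e] by simp
  then have "mat_cong (Suc s) (F p) (mat 1)" by (simp add: mat_cong_def F_def)
  ultimately show ?thesis using mat_cong_trans by blast
qed

lemma periods:
  "\<exists>m>0. \<forall>a. of_nat (m * p ^ a) \<in> I a \<and> (\<forall>x. mat_cong a (M x (m * p ^ a)) (mat 1))"
proof -
  obtain m where m: "m > 0" "of_nat m \<in> I 2" "\<And>x. mat_cong 1 (M x m) (mat 1)"
    using residual_period by blast
  \<comment> \<open>The induction runs with the length one level ahead of the matrix congruence, as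
    \<open>lift_period\<close> demands; both levels are lowered to \<open>a\<close> at the
    end.\<close>
  have "of_nat (m * p ^ a) \<in> I (a + 2) \<and> (\<forall>x. mat_cong (Suc a) (M x (m * p ^ a)) (mat 1))" for a
  proof (induction a)
    case (Suc a)
    have "of_nat p * of_nat (m * p ^ a) \<in> I (1 + (a + 2))" using I_mult[OF p_mem] Suc by blast
    moreover have "mat_cong (Suc (Suc a)) (M x (p * (m * p ^ a))) (mat 1)" for x
      using Suc by (intro lift_period) auto
    ultimately show ?case by (simp add: ac_simps)
  qed (use m in \<open>auto simp: numeral_2_eq_2\<close>)
  moreover have "I (a + 2) \<subseteq> I a" "I (Suc a) \<subseteq> I a" for a by (auto intro!: I_antimono I_Suc)
  ultimately show ?thesis using m(1) unfolding mat_cong_def by (meson subsetD)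
qed

end

section \<open>Saturated submodules\<close>

text \<open>\<open>J\<close> is a submodule of the vectors over \<open>R\<close> supported on
  \<open>D\<close>, and the last assumption says that \<open>v\<close> lies outside its saturation.
  Over the fraction field a linear form vanishing on \<open>J\<close> but not at \<open>v\<close>
  would exist; the induction on \<open>D\<close> is a fraction-free elimination of one coordinate
  that keeps the form over \<open>R\<close>.\<close>

lemma (in subring_of) separating_functional:
  fixes J :: "('i \<Rightarrow> 'a) set"
  assumes no_zero_divisors: "\<And>x y. x \<in> R \<Longrightarrow> y \<in> R \<Longrightarrow> x * y = 0 \<Longrightarrow> x = 0 \<or> y = 0"
    and "finite D"
    and "\<And>w i. w \<in> J \<Longrightarrow> w i \<in> R" "\<And>w i. w \<in> J \<Longrightarrow> i \<notin> D \<Longrightarrow> w i = 0"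
    and "\<And>w w'. w \<in> J \<Longrightarrow> w' \<in> J \<Longrightarrow> (\<lambda>i. w i - w' i) \<in> J"
    and "\<And>c w. c \<in> R \<Longrightarrow> w \<in> J \<Longrightarrow> (\<lambda>i. c * w i) \<in> J"
    and "(\<lambda>_. 0) \<in> J"
    and "\<And>i. v i \<in> R" "\<And>i. i \<notin> D \<Longrightarrow> v i = 0"
    and "\<And>c. c \<in> R \<Longrightarrow> c \<noteq> 0 \<Longrightarrow> (\<lambda>i. c * v i) \<notin> J"
  shows "\<exists>l. (\<forall>i. l i \<in> R) \<and> (\<forall>w\<in>J. (\<Sum>i\<in>D. l i * w i) = 0) \<and> (\<Sum>i\<in>D. l i * v i) \<noteq> 0"
  using assms(2-)
proof (induction D arbitrary: J v rule: finite_induct)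
  case empty
  then have "(\<lambda>i. 1 * v i) = (\<lambda>_. 0)" by auto
  then show ?case using empty.prems(5) empty.prems(8)[of 1] one_mem
    by (metis zero_neq_one)
next
  case (insert k D)
  note prems = insert.prems
  have sum_D: "(\<Sum>i\<in>D. (if i = k then c else g i) * h i) = (\<Sum>i\<in>D. g i * h i)"
    for c and g h :: "'i \<Rightarrow> 'a"
    using insert.hyps by (intro sum.cong) auto
  show ?case
  proof (cases "\<exists>s\<in>J. s k \<noteq> 0")
    case True
    then obtain s where s: "s \<in> J" "s k \<noteq> 0" by blast
    \<comment> \<open>Elimination of coordinate \<open>k\<close> from \<open>v\<close> with pivot
      \<open>s\<close>. A nonzero multiple of \<open>u\<close> in \<open>J\<close> would give one of
      \<open>v\<close>, so \<open>u\<close> inherits the assumption.\<close>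
    define u where "u = (\<lambda>i. s k * v i - v k * s i)"
    have uR: "u i \<in> R" for i
      unfolding u_def by (intro diff_mem mult_mem prems(1)[OF s(1)] prems(6))
    have u_supp: "u i = 0" if "i \<notin> D" for i
      using that prems(2)[OF s(1)] prems(7) by (cases "i = k") (auto simp: u_def mult.commute)
    have "\<exists>l. (\<forall>i. l i \<in> R) \<and> (\<forall>w\<in>{w \<in> J. w k = 0}. (\<Sum>i\<in>D. l i * w i) = 0)
      \<and> (\<Sum>i\<in>D. l i * u i) \<noteq> 0"
    proof (rule insert.IH)
      show "w i = 0" if "w \<in> {w \<in> J. w k = 0}" "i \<notin> D" for w i
        using that prems(2) by (cases "i = k") auto
      show "(\<lambda>i. c * u i) \<notin> {w \<in> J. w k = 0}" if c: "c \<in> R" "c \<noteq> 0" for c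
      proof
        assume "(\<lambda>i. c * u i) \<in> {w \<in> J. w k = 0}"
        then have cu: "(\<lambda>i. c * u i) \<in> J" by simp
        have "(\<lambda>i. (- c * v k) * s i) \<in> J"
          using c s prems(6) by (intro prems(4)[of "- c * v k"] mult_mem uminus_mem)
        with cu have "(\<lambda>i. c * u i - (- c * v k) * s i) \<in> J" by (rule prems(3))
        then have "(\<lambda>i. (c * s k) * v i) \<in> J" by (simp add: u_def algebra_simps)
        moreover have "c * s k \<in> R" "c * s k \<noteq> 0"
          using c s prems(1)[OF s(1)] no_zero_divisors mult_mem by blast+
        ultimately show False using prems(8) by blast
      qed
    qed (use uR u_supp prems in auto)
    then obtain l where l: "\<And>i. l i \<in> R" "\<And>w. w \<in> J \<Longrightarrow> w k = 0 \<Longrightarrow> (\<Sum>i\<in>D. l i * w i) = 0"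
      "(\<Sum>i\<in>D. l i * u i) \<noteq> 0" by auto
    define c where "c = - (\<Sum>i\<in>D. l i * s i)"
    \<comment> \<open>The value \<open>c\<close> at \<open>k\<close> is chosen so that applying
      \<open>l'\<close> to \<open>w\<close> amounts to eliminating coordinate \<open>k\<close> from
      \<open>w\<close> first and applying \<open>l\<close> afterwards.\<close>
    define l' where "l' = (\<lambda>i. if i = k then c else s k * l i)"
    have key: "(\<Sum>i\<in>insert k D. l' i * w i) = (\<Sum>i\<in>D. l i * (s k * w i - w k * s i))" for w
    proof -
      have "(\<Sum>i\<in>insert k D. l' i * w i) = c * w k + (\<Sum>i\<in>D. (s k * l i) * w i)"
        using insert.hyps sum_D by (simp add: l'_def)
      then show ?thesis
        by (simp add: c_def algebra_simps sum_subtractf sum_distrib_left)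
    qed
    have "l' i \<in> R" for i
      using l prems(1)[OF s(1)] by (auto simp: l'_def c_def intro!: mult_mem uminus_mem sum_mem)
    moreover have "(\<Sum>i\<in>insert k D. l' i * w i) = 0" if w: "w \<in> J" for w
    proof -
      have "(\<lambda>i. s k * w i - w k * s i) \<in> J"
        by (intro prems(3) prems(4) w s prems(1))
      then show ?thesis unfolding key by (intro l(2)) simp_all
    qed
    moreover have "(\<Sum>i\<in>insert k D. l' i * v i) \<noteq> 0"
      unfolding key using l(3) by (simp add: u_def)
    ultimately show ?thesis by blast
  next
    case False
    show ?thesis
    proof (cases "v k = 0")
      case True
      have "\<exists>l. (\<forall>i. l i \<in> R) \<and> (\<forall>w\<in>J. (\<Sum>i\<in>D. l i * w i) = 0) \<and> (\<Sum>i\<in>D. l i * v i) \<noteq> 0"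
      proof (rule insert.IH)
        show "w i = 0" if "w \<in> J" "i \<notin> D" for w i
          using that False prems(2) by (cases "i = k") auto
        show "v i = 0" if "i \<notin> D" for i
          using that True prems(7) by (cases "i = k") auto
      qed (use prems in auto)
      then obtain l where "\<And>i. l i \<in> R" "\<And>w. w \<in> J \<Longrightarrow> (\<Sum>i\<in>D. l i * w i) = 0"
        "(\<Sum>i\<in>D. l i * v i) \<noteq> 0" by auto
      then show ?thesis using insert.hyps False True by (intro exI[of _ l]) auto
    next
      \<comment> \<open>Every vector of \<open>J\<close> vanishes at \<open>k\<close> and
        \<open>v\<close> does not, so the coordinate form at \<open>k\<close> separates.\<close>
      case vk: False
      have "(\<Sum>i\<in>insert k D. (if i = k then 1 else 0) * w i) = w k" for w :: "'i \<Rightarrow> 'a"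
        using insert.hyps sum_D[of 1 "\<lambda>_. 0"] by simp
      then show ?thesis using False vk zero_mem one_mem
        by (intro exI[of _ "\<lambda>i. if i = k then 1 else 0"]) auto
    qed
  qed
qed

section \<open>Periodic subvarieties\<close>

lemma eval_coord_superset:
  assumes "finite K" "Poly_Mapping.keys p \<subseteq> K"
  shows "eval_coord p (x, y) = (\<Sum>m\<in>K. poly (Poly_Mapping.lookup p m) x *
    (\<Prod>i\<in>UNIV. (y $ i) ^ Poly_Mapping.lookup m i))"
  unfolding eval_coord_def using assms
  by (auto intro!: sum.mono_neutral_left simp: in_keys_iff)

lemma eval_coord_add: "eval_coord (p + q) z = eval_coord p z + eval_coord q z"
proof -
  obtain x y where "z = (x, y)" by fastforce
  moreover have "eval_coord u (x, y) = (\<Sum>m\<in>Poly_Mapping.keys p \<union> Poly_Mapping.keys q.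
    poly (Poly_Mapping.lookup u m) x * (\<Prod>i\<in>UNIV. (y $ i) ^ Poly_Mapping.lookup m i))"
    if "Poly_Mapping.keys u \<subseteq> Poly_Mapping.keys p \<union> Poly_Mapping.keys q" for u
    using that by (intro eval_coord_superset) auto
  ultimately show ?thesis
    using keys_add[of p q] by (simp add: lookup_add algebra_simps sum.distrib)
qed

lemma eval_coord_sum:
  "finite D \<Longrightarrow> eval_coord (\<Sum>i\<in>D. g i) z = (\<Sum>i\<in>D. eval_coord (g i) z)"
proof (induction D rule: finite_induct)
  case empty
  show ?case by (cases z) (simp add: eval_coord_def)
qed (simp add: eval_coord_add)

lemma eval_coord_single:
  "eval_coord (Poly_Mapping.single m c) (x, y) = poly c x * (\<Prod>i\<in>UNIV. (y $ i) ^ Poly_Mapping.lookup m i)"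
  by (subst eval_coord_superset[of "{m}"]) (auto split: if_splits)

lemma eval_coord_monomial_exists:
  fixes c :: "'k::comm_ring_1 poly" and g :: "'z \<Rightarrow> 'n::finite"
  assumes "finite S"
  shows "\<exists>q. \<forall>x y. eval_coord q (x, y) = poly c x * (\<Prod>z\<in>S. y $ g z)"
proof -
  \<comment> \<open>The exponent of a variable counts how often \<open>g\<close> selects it.\<close>
  define m where "m = Abs_poly_mapping (\<lambda>i. card {z \<in> S. g z = i})"
  have m: "Poly_Mapping.lookup m i = card {z \<in> S. g z = i}" for i
    unfolding m_def by (subst lookup_Abs_poly_mapping) auto
  have "(\<Prod>i\<in>UNIV. (y $ i) ^ Poly_Mapping.lookup m i) = (\<Prod>z\<in>S. y $ g z)" for y :: "'k ^ 'n"
  proof -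
    have "(\<Prod>i\<in>UNIV. (y $ i) ^ Poly_Mapping.lookup m i)
        = (\<Prod>i\<in>UNIV. \<Prod>z\<in>{z \<in> S. g z = i}. y $ g z)"
      unfolding m by (intro prod.cong) simp_all
    also have "\<dots> = (\<Prod>z\<in>S. y $ g z)" using assms by (intro prod.group) auto
    finally show ?thesis .
  qed
  then show ?thesis by (intro exI[of _ "Poly_Mapping.single m c"]) (simp add: eval_coord_single)
qed

text \<open>\<open>V\<close> is the union of its closed subsets cut out by \<open>c\<close> and by
  \<open>h\<close>, so irreducibility makes one of them all of \<open>V\<close>.\<close>

lemma irreducible_subvariety_prime:
  fixes c h :: "('k::idom, 'n::finite) coord_ring"
  assumes V: "irreducible_subvariety V"
    and zero: "\<And>z. z \<in> V \<Longrightarrow> eval_coord c z * eval_coord h z = 0"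
  shows "(\<forall>z\<in>V. eval_coord c z = 0) \<or> (\<forall>z\<in>V. eval_coord h z = 0)"
proof -
  obtain S where S: "V = zero_locus S"
    using V by (auto simp: irreducible_subvariety_def zariski_closed_def)
  define W where "W q = zero_locus (insert q S)" for q
  have W: "W q = {z \<in> V. eval_coord q z = 0}" for q by (auto simp: W_def S zero_locus_def)
  have "V = W c \<union> W h" using zero by (auto simp: W)
  moreover have "zariski_closed (W q)" for q by (auto simp: W_def zariski_closed_def)
  ultimately have "V = W c \<or> V = W h" using V by (auto simp: irreducible_subvariety_def)
  then show ?thesis using W by blast
qed

text \<open>The matrix of \<open>f\<^sup>r\<close>: the product \<open>A(x + r - 1) \<cdots> A(x + 1) A(x)\<close> over \<open>k[x]\<close>.\<close>

definition transfer :: "'k::comm_ring_1 poly ^ 'n ^ 'n \<Rightarrow> nat \<Rightarrow> 'k poly ^ 'n ^ 'n" where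
  "transfer A = cocycle_prod (\<lambda>r. map_matrix (\<lambda>q. pcompose q [:of_nat r, 1:]) A) 0"

lemma map_matrix_poly_mult:
  "map_matrix (\<lambda>q. poly q x) (X ** Y) = map_matrix (\<lambda>q. poly q x) X ** map_matrix (\<lambda>q. poly q x) Y"
  by (simp add: vec_eq_iff matrix_matrix_mult_def poly_sum)

lemma map_matrix_poly_1: "map_matrix (\<lambda>q. poly q x) (mat 1) = mat 1"
  by (simp add: vec_eq_iff mat_def)

lemma transfer_at_nat:
  "map_matrix (\<lambda>q. poly q (of_nat j)) (transfer A r)
    = cocycle_prod (\<lambda>x. map_matrix (\<lambda>q. poly q (of_nat x)) A) j r"
proof (induction r)
  case (Suc r)
  have "map_matrix (\<lambda>q. poly q (of_nat j)) (map_matrix (\<lambda>q. pcompose q [:of_nat r, 1:]) A)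
    = map_matrix (\<lambda>q. poly q (of_nat (j + r))) A"
    by (simp add: vec_eq_iff poly_pcompose add.commute)
  then show ?case using Suc by (simp add: transfer_def map_matrix_poly_mult)
qed (simp add: transfer_def map_matrix_poly_1)

lemma funpow_shift_cocycle:
  "(shift_cocycle A ^^ r) (x, y) = (x + of_nat r, map_matrix (\<lambda>q. poly q x) (transfer A r) *v y)"
proof (induction r)
  case 0
  show ?case by (simp add: transfer_def map_matrix_poly_1)
next
  case (Suc r)
  have "map_matrix (\<lambda>q. poly q x) (map_matrix (\<lambda>q. pcompose q [:of_nat r, 1:]) A)
    = map_matrix (\<lambda>q. poly q (x + of_nat r)) A"
    by (simp add: vec_eq_iff poly_pcompose add.commute)
  then show ?case using Suc
    by (simp add: transfer_def shift_cocycle_def map_matrix_poly_mult matrix_vector_mul_assoc)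
qed

section \<open>Cancellation on periodic subvarieties and divisibility of periods\<close>

lemma funpow_image_mult:
  assumes "(f ^^ n) ` V = V"
  shows "(f ^^ (n * k)) ` V = V"
proof (induction k)
  case (Suc k)
  have "(f ^^ (n * Suc k)) ` V = (f ^^ n) ` (f ^^ (n * k)) ` V"
    by (simp add: funpow_add image_comp o_def)
  then show ?case using Suc assms by simp
qed simp

text \<open>A nonzero polynomial in \<open>x\<close> alone cannot vanish on \<open>V\<close>: the
  orbit of a point under the n-th iterate stays in \<open>V\<close> and has infinitely many first
  coordinates in characteristic 0. Primality then removes the factor \<open>c\<close>. This is what
  makes the module of relations on \<open>V\<close> saturated.\<close>

lemma periodic_subvariety_cancel:
  fixes A :: "'k::{idom,ring_char_0} poly ^ 'n ^ 'n"
  assumes V: "periodic_subvariety (shift_cocycle A) V" and c: "c \<noteq> 0"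
    and zero: "\<And>x y. (x, y) \<in> V \<Longrightarrow> poly c x * eval_coord h (x, y) = 0"
    and z: "z \<in> V"
  shows "eval_coord h z = 0"
proof -
  have irr: "irreducible_subvariety V" using V by (simp add: periodic_subvariety_def)
  obtain n where n: "n \<ge> 1" "(shift_cocycle A ^^ n) ` V = V"
    using V by (auto simp: periodic_subvariety_def)
  obtain x0 y0 where z0: "(x0, y0) \<in> V" using z by (cases z) auto
  define C :: "('k, 'n) coord_ring" where "C = Poly_Mapping.single 0 c"
  have C: "eval_coord C (x, y) = poly c x" for x y by (simp add: C_def eval_coord_single)
  have "(\<forall>z\<in>V. eval_coord C z = 0) \<or> (\<forall>z\<in>V. eval_coord h z = 0)"
  proof (rule irreducible_subvariety_prime[OF irr])
    show "eval_coord C z * eval_coord h z = 0" if "z \<in> V" for z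
      using zero[of "fst z" "snd z"] C[of "fst z" "snd z"] that by simp
  qed
  moreover have "\<not> (\<forall>z\<in>V. eval_coord C z = 0)"
  proof
    assume C0: "\<forall>z\<in>V. eval_coord C z = 0"
    have "poly c (x0 + of_nat (n * k)) = 0" for k
    proof -
      have "(shift_cocycle A ^^ (n * k)) (x0, y0) \<in> V" using funpow_image_mult[OF n(2)] z0 by blast
      then show ?thesis using C0 C unfolding funpow_shift_cocycle by metis
    qed
    then have "range (\<lambda>k. x0 + of_nat (n * k)) \<subseteq> {x. poly c x = 0}" by auto
    moreover have "inj (\<lambda>k. x0 + of_nat (n * k))"
      using n(1) by (auto simp: inj_def simp del: of_nat_mult)
    ultimately show False
      using poly_roots_finite[OF c] finite_subset finite_imageD infinite_UNIV_nat by metis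
  qed
  ultimately show ?thesis using z by blast
qed

lemma period_dvd:
  assumes V: "periodic_subvariety f V" and L: "L \<ge> 1" "(f ^^ L) ` V \<subseteq> V"
  shows "period f V dvd L"
proof -
  define n where "n = period f V"
  have n: "n \<ge> 1" "(f ^^ n) ` V = V"
    using V LeastI_ex[of "\<lambda>n. n \<ge> 1 \<and> (f ^^ n) ` V = V"]
    by (auto simp: periodic_subvariety_def n_def period_def)
  have least: "n \<le> k" if "k \<ge> 1" "(f ^^ k) ` V = V" for k
    unfolding n_def period_def by (rule Least_le) (use that in blast)
  have iter: "(f ^^ (L * k)) ` V \<subseteq> V" for k
  proof (induction k)
    case (Suc k)
    have "(f ^^ (L * Suc k)) ` V = (f ^^ L) ` (f ^^ (L * k)) ` V"
      by (simp add: funpow_add image_comp o_def)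
    then show ?case using Suc L(2) by blast
  qed simp
  \<comment> \<open>The inclusion for \<open>L\<close> becomes an equality by sandwiching: the
    iterate \<open>n * L\<close> maps \<open>V\<close> onto \<open>V\<close> and its last
    \<open>L\<close> steps start inside \<open>V\<close>.\<close>
  have "V = (f ^^ (n * L)) ` V" using funpow_image_mult[OF n(2)] by simp
  also have "n * L = L + L * (n - 1)" using n(1) by (cases n) auto
  also have "(f ^^ (L + L * (n - 1))) ` V = (f ^^ L) ` (f ^^ (L * (n - 1))) ` V"
    by (simp add: funpow_add image_comp o_def)
  also have "\<dots> \<subseteq> (f ^^ L) ` V" using iter by blast
  finally have LV: "(f ^^ L) ` V = V" using L(2) by blast
  have "f ^^ L = f ^^ (L mod n) \<circ> f ^^ (n * (L div n))"
    by (metis funpow_add mod_mult_div_eq)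
  then have "(f ^^ L) ` V = (f ^^ (L mod n)) ` (f ^^ (n * (L div n))) ` V"
    by (simp add: image_comp)
  then have "(f ^^ (L mod n)) ` V = V" using LV funpow_image_mult[OF n(2)] by simp
  then have "L mod n = 0" using least[of "L mod n"] n(1) by (meson less_one mod_less_divisor not_le order_less_le_trans zero_less_one)
  then show ?thesis by (auto simp: n_def)
qed

text \<open>A polynomial \<open>P\<close> is expanded along the orbit as \<open>P \<circ> f\<^sup>r = \<Sum>\<^sub>\<iota> \<kappa>\<^sub>\<iota> v\<^sub>\<iota>(r) Y\<^sub>\<iota>\<close>, where the
  scalars \<open>\<kappa>\<^sub>\<iota>\<close> and the monomials \<open>Y\<^sub>\<iota>\<close> in \<open>y\<close> do not depend on \<open>r\<close>, and \<open>v\<^sub>\<iota>(r)\<close> is a polynomial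
  in \<open>x\<close> over the ring generated by the coefficients of \<open>A\<close>. An index consists of an exponent
  vector \<open>m\<close>, a power of \<open>x\<close> and a choice \<open>g\<close> of a summand in every linear factor of \<open>y\<^sup>m\<close>; the
  factors are numbered by the slots \<open>(i, c)\<close> with \<open>c < m\<^sub>i\<close>.\<close>

type_synonym 'n expansion_index = "('n \<Rightarrow>\<^sub>0 nat) \<times> nat \<times> ('n \<times> nat \<Rightarrow> 'n)"

definition slots :: "('n::finite \<Rightarrow>\<^sub>0 nat) \<Rightarrow> ('n \<times> nat) set" where
  "slots m = Sigma UNIV (\<lambda>i. {..<Poly_Mapping.lookup m i})"

definition expansion_set :: "('k::comm_ring_1, 'n::finite) coord_ring \<Rightarrow> 'n expansion_index set" where
  "expansion_set P = Sigma (Poly_Mapping.keys P) (\<lambda>m.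
     {..degree (Poly_Mapping.lookup P m)} \<times> PiE (slots m) (\<lambda>_. UNIV))"

definition expansion_scalar :: "('k::comm_ring_1, 'n::finite) coord_ring \<Rightarrow> 'n expansion_index \<Rightarrow> 'k" where
  "expansion_scalar P = (\<lambda>(m, a, g). coeff (Poly_Mapping.lookup P m) a)"

definition expansion_monomial :: "'k::comm_ring_1 ^ 'n::finite \<Rightarrow> 'n expansion_index \<Rightarrow> 'k" where
  "expansion_monomial y = (\<lambda>(m, a, g). \<Prod>z\<in>slots m. y $ g z)"

definition expansion_poly :: "'k::comm_ring_1 poly ^ 'n ^ 'n \<Rightarrow> nat \<Rightarrow> 'n::finite expansion_index \<Rightarrow> 'k poly" where
  "expansion_poly A r = (\<lambda>(m, a, g).
     [:of_nat r, 1:] ^ a * (\<Prod>z\<in>slots m. transfer A r $ fst z $ g z))"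

lemma finite_slots: "finite (slots m)"
  by (simp add: slots_def)

lemma finite_expansion_set: "finite (expansion_set P)"
  unfolding expansion_set_def by (intro finite_SigmaI finite_cartesian_product finite_PiE finite_slots) auto

text \<open>Each coordinate of the iterate is a linear form in \<open>y\<close>. Multiplying out the
  product of these forms over the slots of \<open>m\<close> gives one summand for every choice
  \<open>g\<close>.\<close>

lemma eval_coord_funpow:
  "eval_coord P ((shift_cocycle A ^^ r) (x, y)) =
    (\<Sum>\<iota>\<in>expansion_set P. expansion_scalar P \<iota> * poly (expansion_poly A r \<iota>) x * expansion_monomial y \<iota>)"
proof -
  define M where "M = map_matrix (\<lambda>q. poly q x) (transfer A r)"
  have "(\<Prod>i\<in>UNIV. ((M *v y) $ i) ^ Poly_Mapping.lookup m i)
      = (\<Sum>g\<in>PiE (slots m) (\<lambda>_. UNIV). (\<Prod>z\<in>slots m. M $ fst z $ g z) * (\<Prod>z\<in>slots m. y $ g z))" for m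
  proof -
    have "(\<Prod>i\<in>UNIV. ((M *v y) $ i) ^ Poly_Mapping.lookup m i)
        = (\<Prod>i\<in>UNIV. \<Prod>c<Poly_Mapping.lookup m i. (M *v y) $ i)"
      by simp
    also have "\<dots> = (\<Prod>z\<in>slots m. (M *v y) $ fst z)"
      unfolding slots_def by (subst prod.Sigma) (auto simp: split_beta)
    also have "\<dots> = (\<Prod>z\<in>slots m. \<Sum>j\<in>UNIV. M $ fst z $ j * y $ j)"
      by (simp add: matrix_vector_mult_def)
    also have "\<dots> = (\<Sum>g\<in>PiE (slots m) (\<lambda>_. UNIV). \<Prod>z\<in>slots m. M $ fst z $ g z * y $ g z)"
      by (rule prod_sum_PiE) (auto simp: finite_slots)
    finally show ?thesis by (simp add: prod.distrib)
  qed
  then have "eval_coord P ((shift_cocycle A ^^ r) (x, y)) = (\<Sum>m\<in>Poly_Mapping.keys P.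
      (\<Sum>a\<le>degree (Poly_Mapping.lookup P m). coeff (Poly_Mapping.lookup P m) a * (x + of_nat r) ^ a) *
      (\<Sum>g\<in>PiE (slots m) (\<lambda>_. UNIV). (\<Prod>z\<in>slots m. M $ fst z $ g z) * (\<Prod>z\<in>slots m. y $ g z)))"
    unfolding funpow_shift_cocycle M_def[symmetric] eval_coord_def by (simp add: poly_altdef)
  also have "\<dots> = (\<Sum>m\<in>Poly_Mapping.keys P.
      \<Sum>(a, g)\<in>{..degree (Poly_Mapping.lookup P m)} \<times> PiE (slots m) (\<lambda>_. UNIV).
      coeff (Poly_Mapping.lookup P m) a * (x + of_nat r) ^ a *
      ((\<Prod>z\<in>slots m. M $ fst z $ g z) * (\<Prod>z\<in>slots m. y $ g z)))"
    by (simp add: sum_product sum.cartesian_product)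
  also have "\<dots> = (\<Sum>(m, a, g)\<in>expansion_set P.
      coeff (Poly_Mapping.lookup P m) a * (x + of_nat r) ^ a *
      ((\<Prod>z\<in>slots m. M $ fst z $ g z) * (\<Prod>z\<in>slots m. y $ g z)))"
    unfolding expansion_set_def
    by (subst sum.Sigma) (auto simp: finite_slots intro!: finite_PiE)
  also have "\<dots> = (\<Sum>\<iota>\<in>expansion_set P. expansion_scalar P \<iota> * poly (expansion_poly A r \<iota>) x * expansion_monomial y \<iota>)"
    by (intro sum.cong refl)
       (auto simp: expansion_scalar_def expansion_poly_def expansion_monomial_def M_def poly_prod
             algebra_simps)
  finally show ?thesis .
qed

text \<open>Combinations with arbitrary coefficients \<open>w\<close> are again coordinate
  polynomials, so that the cancellation on \<open>V\<close> applies to them.\<close>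

lemma expansion_polyfunction:
  fixes P :: "('k::comm_ring_1, 'n::finite) coord_ring"
  shows "\<exists>h. \<forall>x y. eval_coord h (x, y) =
    (\<Sum>\<iota>\<in>expansion_set P. expansion_scalar P \<iota> * poly (w \<iota>) x * expansion_monomial y \<iota>)"
proof -
  have "\<exists>h. \<forall>x y. eval_coord h (x, y) = expansion_scalar P \<iota> * poly (w \<iota>) x * expansion_monomial y \<iota>" for \<iota>
  proof -
    obtain m a g where \<iota>: "\<iota> = (m, a, g)" by (metis prod.exhaust)
    obtain h :: "('k, 'n) coord_ring" where "\<forall>x y. eval_coord h (x, y) =
        poly (smult (expansion_scalar P \<iota>) (w \<iota>)) x * (\<Prod>z\<in>slots m. y $ g z)"
      using eval_coord_monomial_exists[OF finite_slots] by blast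
    then show ?thesis by (intro exI[of _ h]) (simp add: \<iota> expansion_monomial_def)
  qed
  then obtain H where "\<And>\<iota> x y. eval_coord (H \<iota>) (x, y)
      = expansion_scalar P \<iota> * poly (w \<iota>) x * expansion_monomial y \<iota>" by metis
  then show ?thesis
    by (intro exI[of _ "\<Sum>\<iota>\<in>expansion_set P. H \<iota>"]) (simp add: eval_coord_sum finite_expansion_set)
qed

section \<open>Congruences and linear relations along an orbit\<close>

lemma (in adic_filtration) I_prod_cong:
  assumes "\<And>z. z \<in> S \<Longrightarrow> g z \<in> R" "\<And>z. z \<in> S \<Longrightarrow> h z \<in> R" "\<And>z. z \<in> S \<Longrightarrow> g z - h z \<in> I s"
  shows "prod g S - prod h S \<in> I s"
  using assms
proof (induction S rule: infinite_finite_induct)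
  case (insert z S)
  have "prod g (insert z S) - prod h (insert z S) =
    (g z - h z) * prod g S + h z * (prod g S - prod h S)"
    using insert.hyps by (simp add: algebra_simps)
  also have "\<dots> \<in> I s"
  proof (intro I_add)
    show "(g z - h z) * prod g S \<in> I s" using insert.prems by (intro I_scale_right prod_mem) auto
    show "h z * (prod g S - prod h S) \<in> I s" using insert by (intro I_scale) auto
  qed
  finally show ?case .
qed (simp_all add: I_zero)

lemma (in adic_filtration) expansion_poly_cong:
  fixes A :: "'a poly ^ 'n ^ 'n" and j r r' s :: nat
  assumes A: "\<And>x r. mat_over (cocycle_prod (\<lambda>x. map_matrix (\<lambda>q. poly q (of_nat x)) A) x r)"
    and d: "of_nat r' - of_nat r \<in> I s"
    and M: "mat_cong s (map_matrix (\<lambda>q. poly q (of_nat j)) (transfer A r'))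
      (map_matrix (\<lambda>q. poly q (of_nat j)) (transfer A r))"
  shows "poly (expansion_poly A r' \<iota>) (of_nat j) - poly (expansion_poly A r \<iota>) (of_nat j) \<in> I s"
proof -
  obtain m a g where \<iota>: "\<iota> = (m, a, g)" by (metis prod.exhaust)
  \<comment> \<open>The power of \<open>x + r\<close> and the product of matrix entries are packaged
    as one product over the two booleans, so that \<open>I_prod_cong\<close> handles each factor and
    then the whole.\<close>
  define F where "F r b = (if b then \<Prod>_<a. of_nat r + of_nat j
      else \<Prod>z\<in>slots m. poly (transfer A r $ fst z $ g z) (of_nat j))" for r b
  have val: "poly (expansion_poly A r \<iota>) (of_nat j) = prod (F r) UNIV" for r
    by (simp add: \<iota> expansion_poly_def poly_prod UNIV_bool F_def mult.commute)
  have entry: "poly (transfer A r $ i $ k) (of_nat j) \<in> R" for r i k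
    using A[of j r] unfolding transfer_at_nat[symmetric] by (simp add: mat_over_def)
  have "F r b \<in> R" for r b
    unfolding F_def by (auto simp del: prod_constant intro!: prod_mem add_mem of_nat_mem entry)
  moreover have "F r' b - F r b \<in> I s" for b
  proof (cases b)
    case True
    then show ?thesis using d
      by (auto simp: F_def simp del: prod_constant intro!: I_prod_cong add_mem of_nat_mem)
  next
    case False
    then show ?thesis using M
      by (auto simp: F_def mat_cong_def intro!: I_prod_cong entry)
  qed
  ultimately show ?thesis unfolding val by (intro I_prod_cong)
qed

lemma transfer_over:
  assumes R: "subring_of R" and A: "\<And>i j. A $ i $ j \<in> polys_over R"
  shows "transfer A r $ i $ j \<in> polys_over R"
proof -
  interpret subring_of R by (rule R)
  interpret P: subring_of "polys_over R" by (rule polys_over_subring)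
  have "P.mat_over (cocycle_prod (\<lambda>r. map_matrix (\<lambda>q. pcompose q [:of_nat r, 1:]) A) 0 r)"
  proof (induction r)
    case (Suc r)
    have "P.mat_over (map_matrix (\<lambda>q. pcompose q [:of_nat r, 1:]) A)"
      by (auto simp: P.mat_over_def intro!: pcompose_in_polys_over A linear_in_polys_over of_nat_mem)
    then show ?case using Suc by (simp add: P.mat_over_mult)
  qed (simp add: P.mat_over_1)
  then show ?thesis by (simp add: P.mat_over_def transfer_def)
qed

lemma expansion_poly_over:
  assumes R: "subring_of R" and A: "\<And>i j. A $ i $ j \<in> polys_over R"
  shows "expansion_poly A r \<iota> \<in> polys_over R"
proof -
  interpret subring_of R by (rule R)
  interpret P: subring_of "polys_over R" by (rule polys_over_subring)
  show ?thesis unfolding expansion_poly_def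
    by (auto simp: split_beta
        intro!: P.mult_mem P.power_mem P.prod_mem transfer_over[OF R A] linear_in_polys_over of_nat_mem)
qed

text \<open>\<open>separating_functional\<close> is applied over polynomials in \<open>x\<close>
  with coefficients in \<open>R\<close>. The module \<open>J\<close> consists of the coefficient
  vectors whose combination vanishes on \<open>V\<close>; it contains those of the iterates
  \<open>n * k\<close>, because these map \<open>V\<close> to itself.\<close>

lemma orbit_functional:
  fixes A :: "'k::{idom,ring_char_0} poly ^ 'n ^ 'n"
  assumes R: "subring_of R" and A: "\<And>i j. A $ i $ j \<in> polys_over R"
    and V: "periodic_subvariety (shift_cocycle A) V"
    and n: "(shift_cocycle A ^^ n) ` V = V"
    and P: "\<And>z. z \<in> V \<Longrightarrow> eval_coord P z = 0"
    and z: "z \<in> V" "eval_coord P ((shift_cocycle A ^^ L) z) \<noteq> 0"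
  shows "\<exists>l. (\<forall>\<iota>. l \<iota> \<in> polys_over R) \<and>
    (\<forall>k. (\<Sum>\<iota>\<in>expansion_set P. l \<iota> * expansion_poly A (n * k) \<iota>) = 0) \<and>
    (\<Sum>\<iota>\<in>expansion_set P. l \<iota> * expansion_poly A L \<iota>) \<noteq> 0"
proof -
  interpret subring_of R by (rule R)
  interpret PR: subring_of "polys_over R" by (rule polys_over_subring)
  define D where "D = expansion_set P"
  define h where "h w x y = (\<Sum>\<iota>\<in>D. expansion_scalar P \<iota> * poly (w \<iota>) x * expansion_monomial y \<iota>)"
    for w x y
  define v where "v r \<iota> = (if \<iota> \<in> D then expansion_poly A r \<iota> else 0)" for r \<iota>
  define J where "J = {w. (\<forall>\<iota>. w \<iota> \<in> polys_over R) \<and> (\<forall>\<iota>. \<iota> \<notin> D \<longrightarrow> w \<iota> = 0) \<and>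
    (\<forall>x y. (x, y) \<in> V \<longrightarrow> h w x y = 0)}"
  have vR: "v r \<iota> \<in> polys_over R" for r \<iota>
    using expansion_poly_over[OF R A] by (simp add: v_def PR.zero_mem)
  have hv: "h (v r) x y = eval_coord P ((shift_cocycle A ^^ r) (x, y))" for r x y
    unfolding eval_coord_funpow h_def D_def by (intro sum.cong) (auto simp: v_def D_def)
  have h_scale: "h (\<lambda>\<iota>. c * w \<iota>) x y = poly c x * h w x y" for c w x y
    by (simp add: h_def sum_distrib_left algebra_simps)
  have h_diff: "h (\<lambda>\<iota>. w \<iota> - w' \<iota>) x y = h w x y - h w' x y" for w w' x y
    by (simp add: h_def algebra_simps sum_subtractf)
  have vJ: "v (n * k) \<in> J" for k
  proof -
    have "h (v (n * k)) x y = 0" if "(x, y) \<in> V" for x y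
      unfolding hv using funpow_image_mult[OF n, of k] that by (intro P) blast
    then show ?thesis using vR by (auto simp: J_def v_def)
  qed
  have "\<exists>l. (\<forall>\<iota>. l \<iota> \<in> polys_over R) \<and> (\<forall>w\<in>J. (\<Sum>\<iota>\<in>D. l \<iota> * w \<iota>) = 0)
    \<and> (\<Sum>\<iota>\<in>D. l \<iota> * v L \<iota>) \<noteq> 0"
  proof (rule PR.separating_functional)
    show "finite D" unfolding D_def by (rule finite_expansion_set)
    show "(\<lambda>\<iota>. w \<iota> - w' \<iota>) \<in> J" if "w \<in> J" "w' \<in> J" for w w'
      using that by (auto simp: J_def h_diff PR.diff_mem)
    show "(\<lambda>\<iota>. c * w \<iota>) \<in> J" if "c \<in> polys_over R" "w \<in> J" for c w
      using that by (auto simp: J_def h_scale PR.mult_mem)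
    show "(\<lambda>_. 0) \<in> J" by (auto simp: J_def h_def PR.zero_mem)
    \<comment> \<open>If a nonzero multiple vanished on \<open>V\<close>, cancelling
      \<open>c\<close> would force \<open>P\<close> to vanish at the image of
      \<open>z\<close>.\<close>
    show "(\<lambda>\<iota>. c * v L \<iota>) \<notin> J" if c: "c \<noteq> 0" for c
    proof
      assume "(\<lambda>\<iota>. c * v L \<iota>) \<in> J"
      then have zero: "poly c x * h (v L) x y = 0" if "(x, y) \<in> V" for x y
        using that unfolding h_scale[symmetric] by (simp add: J_def)
      obtain q where q: "\<And>x y. eval_coord q (x, y) = h (v L) x y"
        using expansion_polyfunction[of P "v L"] unfolding h_def D_def by blast
      have "eval_coord q z = 0"
        using periodic_subvariety_cancel[OF V c _ z(1), of q] zero q by simp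
      then show False using z(2) q hv by (metis surj_pair)
    qed
  qed (auto simp: J_def v_def vR PR.zero_mem expansion_poly_over[OF R A])
  then obtain l where l: "\<And>\<iota>. l \<iota> \<in> polys_over R" "\<And>w. w \<in> J \<Longrightarrow> (\<Sum>\<iota>\<in>D. l \<iota> * w \<iota>) = 0"
    "(\<Sum>\<iota>\<in>D. l \<iota> * v L \<iota>) \<noteq> 0" by blast
  have "(\<Sum>\<iota>\<in>D. l \<iota> * v r \<iota>) = (\<Sum>\<iota>\<in>D. l \<iota> * expansion_poly A r \<iota>)" for r
    by (intro sum.cong) (auto simp: v_def)
  then show ?thesis using l(1) l(2)[OF vJ] l(3) unfolding D_def by (intro exI[of _ l]) simp
qed

section \<open>The bound on the period\<close>

text \<open>The number \<open>m\<close> comes from \<open>periods\<close>, hence from the filtration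
  and the matrix, and is fixed before \<open>V\<close>; only the exponent \<open>b\<close> varies
  with \<open>V\<close>.\<close>

lemma period_dvd_prime_power:
  fixes A B :: "'k::{idom,ring_char_0} poly ^ 'n ^ 'n"
  assumes I: "adic_filtration R I p" and p: "prime p"
    and A: "\<And>i j. A $ i $ j \<in> polys_over R" and B: "\<And>i j. B $ i $ j \<in> polys_over R"
    and AB: "A ** B = mat 1"
  shows "\<exists>m>0. \<forall>V. periodic_subvariety (shift_cocycle A) V \<longrightarrow>
    (\<exists>b. period (shift_cocycle A) V dvd m * p ^ b)"
proof -
  interpret adic_filtration R I p by (rule I)
  define ev where "ev X x = map_matrix (\<lambda>q. poly q (of_nat x)) X"
    for X :: "'k poly ^ 'n ^ 'n" and x :: nat
  interpret adic_cocycle R I p "ev A" "ev B"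
  proof
    show "mat_over (ev A x)" "mat_over (ev B x)" for x
      using A B by (auto simp: mat_over_def ev_def intro: poly_mem of_nat_mem)
    show "ev A x ** ev B x = mat 1" for x
      by (simp add: ev_def AB map_matrix_poly_1 flip: map_matrix_poly_mult)
    show "mat_cong s (ev A (x + d)) (ev A x)" if d: "of_nat d \<in> I s" for d s x
      unfolding mat_cong_def
    proof (intro allI)
      fix i j
      obtain c where "c \<in> R" "poly (A $ i $ j) (of_nat x + of_nat d) - poly (A $ i $ j) (of_nat x) = c * of_nat d"
        using poly_diff_scale[OF A of_nat_mem of_nat_mem] by blast
      then show "ev A (x + d) $ i $ j - ev A x $ i $ j \<in> I s"
        using I_scale d by (simp add: ev_def)
    qed
  qed (rule p)
  obtain m where m: "m > 0" "\<And>a. of_nat (m * p ^ a) \<in> I a"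
    "\<And>a x. mat_cong a (M x (m * p ^ a)) (mat 1)" using periods by blast
  have "\<exists>b. period (shift_cocycle A) V dvd m * p ^ b"
    if V: "periodic_subvariety (shift_cocycle A) V" for V
  proof -
    define n where "n = period (shift_cocycle A) V"
    have n: "n \<ge> 1" "(shift_cocycle A ^^ n) ` V = V"
      using V LeastI_ex[of "\<lambda>n. n \<ge> 1 \<and> (shift_cocycle A ^^ n) ` V = V"]
      by (auto simp: periodic_subvariety_def n_def period_def)
    obtain n1 where n1: "n = p ^ multiplicity p n * n1" "\<not> p dvd n1"
      using multiplicity_decompose'[of n p] n(1) p by (auto simp: prime_nat_iff)
    define b where "b = multiplicity p n"
    define L where "L = m * p ^ b"
    have "(shift_cocycle A ^^ L) ` V \<subseteq> V"
    proof (rule ccontr)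
      assume "\<not> ?thesis"
      then obtain z where z: "z \<in> V" "(shift_cocycle A ^^ L) z \<notin> V" by blast
      obtain S where S: "V = zero_locus S"
        using V by (auto simp: periodic_subvariety_def irreducible_subvariety_def zariski_closed_def)
      obtain P where P: "P \<in> S" "eval_coord P ((shift_cocycle A ^^ L) z) \<noteq> 0"
        using z(2) by (auto simp: S zero_locus_def)
      have PV: "eval_coord P z = 0" if "z \<in> V" for z using that P(1) by (simp add: S zero_locus_def)
      obtain l where l: "\<And>\<iota>. l \<iota> \<in> polys_over R"
        "\<And>k. (\<Sum>\<iota>\<in>expansion_set P. l \<iota> * expansion_poly A (n * k) \<iota>) = 0"
        "(\<Sum>\<iota>\<in>expansion_set P. l \<iota> * expansion_poly A L \<iota>) \<noteq> 0"
        using orbit_functional[OF subring_of_axioms A V n(2) PV z(1) P(2)] by blast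
      define U where "U r = (\<Sum>\<iota>\<in>expansion_set P. l \<iota> * expansion_poly A r \<iota>)" for r
      have "finite {x. poly (U L) x = 0}" using l(3) by (intro poly_roots_finite) (simp add: U_def)
      moreover have "infinite (range of_nat :: 'k set)" by (simp add: range_inj_infinite inj_on_def)
      ultimately obtain j where j: "poly (U L) (of_nat j) \<noteq> 0"
        by (metis (mono_tags, lifting) finite_subset image_subsetI mem_Collect_eq)
      have "poly (U L) (of_nat j) \<in> I s" for s
      proof -
        \<comment> \<open>Large enough for the congruence at level \<open>s\<close>, and at least
          \<open>b\<close> so that \<open>p ^ b\<close> divides \<open>p ^ a\<close>.\<close>
        define a where "a = max s b"
        have "coprime n1 (p ^ (a - b))"
          using n1(2) p by (metis coprime_commute coprime_power_right_iff prime_imp_coprime)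
        moreover have "n1 \<noteq> 0" using n1(2) by (metis dvd_0_right)
        \<comment> \<open>This choice of \<open>k\<close> makes \<open>n * (m * k)\<close>, a
          multiple of the period, exceed \<open>L\<close> by a multiple of the trivial length
          \<open>m * p ^ a\<close>.\<close>
        ultimately obtain k t where kt: "n1 * k = p ^ (a - b) * t + 1"
          using bezout_nat[of n1 "p ^ (a - b)"] by (auto simp: coprime_iff_gcd_eq_1)
        have "p ^ b * p ^ (a - b) = p ^ a" by (simp add: a_def flip: power_add)
        have "n * (m * k) = m * p ^ b * (n1 * k)" using n1(1) by (simp add: ac_simps b_def)
        also have "\<dots> = L + t * (m * (p ^ b * p ^ (a - b)))" unfolding kt L_def by (simp add: algebra_simps)
        finally have nk: "n * (m * k) = L + t * (m * p ^ a)" unfolding \<open>p ^ b * p ^ (a - b) = p ^ a\<close> .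
        have "I a \<subseteq> I s" by (rule I_antimono) (simp add: a_def)
        then have per: "of_nat (m * p ^ a) \<in> I s" "mat_cong s (M x (m * p ^ a)) (mat 1)" for x
          using m(2)[of a] m(3)[of a x] by (auto simp: mat_cong_def)
        \<comment> \<open>The surplus factor beyond the first \<open>L\<close> steps is trivial
          modulo \<open>I s\<close>.\<close>
        have "mat_cong s (M (j + L) (t * (m * p ^ a)) ** M j L) (mat 1 ** M j L)"
          by (intro mat_cong_mult M_multiple per mat_cong_refl mat_over_1 M_over)
        then have cong: "mat_cong s (M j (n * (m * k))) (M j L)" by (simp add: nk cocycle_prod_add)
        have M_ev: "M x r = ev (transfer A r) x" for x r
          unfolding ev_def using transfer_at_nat[of x A r] by simp
        have "poly (expansion_poly A (n * (m * k)) \<iota>) (of_nat j) - poly (expansion_poly A L \<iota>) (of_nat j) \<in> I s" for \<iota>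
        proof (rule expansion_poly_cong)
          show "mat_over (cocycle_prod (\<lambda>x. map_matrix (\<lambda>q. poly q (of_nat x)) A) x r)" for x r
            using M_over[of x r] unfolding ev_def[abs_def] .
          show "of_nat (n * (m * k)) - of_nat L \<in> I s"
            using of_nat_multiple[OF per(1), of t] by (simp add: nk)
          show "mat_cong s (map_matrix (\<lambda>q. poly q (of_nat j)) (transfer A (n * (m * k))))
             (map_matrix (\<lambda>q. poly q (of_nat j)) (transfer A L))"
            using cong unfolding M_ev ev_def .
        qed
        then have "(\<Sum>\<iota>\<in>expansion_set P. poly (l \<iota>) (of_nat j) *
            (poly (expansion_poly A (n * (m * k)) \<iota>) (of_nat j)
              - poly (expansion_poly A L \<iota>) (of_nat j))) \<in> I s"
          by (intro I_sum I_scale poly_mem l(1) of_nat_mem)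
        then have "poly (U (n * (m * k)) - U L) (of_nat j) \<in> I s"
          by (simp add: U_def poly_sum algebra_simps sum_subtractf)
        moreover have "U (n * (m * k)) = 0" using l(2) by (simp only: U_def)
        ultimately have "- poly (U L) (of_nat j) \<in> I s" by simp
        then show ?thesis using I_uminus by fastforce
      qed
      then show False using I_separated j by blast
    qed
    moreover have "L \<ge> 1" using m(1) p by (simp add: L_def prime_gt_0_nat Suc_le_eq)
    ultimately show ?thesis using period_dvd[OF V] unfolding L_def by blast
  qed
  then show ?thesis using m(1) by blast
qed

theorem theorem1p8:
  fixes A :: "'k::{alg_closed_field, field_char_0} poly ^ 'n ^ 'n"
  assumes "invertible A"
  shows "\<exists>C::nat. \<forall>V. periodic_subvariety (shift_cocycle A) V \<longrightarrow> period (shift_cocycle A) V \<le> C"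
proof -
  obtain B where AB: "A ** B = mat 1" using assms by (auto simp: invertible_def)
  define X where "X = (\<Union>i. \<Union>j. set (coeffs (A $ i $ j)) \<union> set (coeffs (B $ i $ j)))"
  have "finite X" by (simp add: X_def)
  then obtain R where R: "good_ring R" "X \<subseteq> R" using finite_subset_good_ring by blast
  interpret subring_of R using R(1) by (simp add: good_ring_def)
  have over: "q \<in> polys_over R" if "set (coeffs q) \<subseteq> X" for q
  proof -
    have "coeff q i \<in> R" for i
      using that R(2) zero_mem range_coeff[of q] by (metis insert_iff rangeI subsetD)
    then show ?thesis by (simp add: polys_over_def)
  qed
  have A: "A $ i $ j \<in> polys_over R" and B: "B $ i $ j \<in> polys_over R" for i j
    by (rule over; force simp: X_def)+
  \<comment> \<open>The good-ring property is applied to the element 1, just to obtain filtrations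
    for all large primes.\<close>
  obtain N where N: "\<And>p. p > N \<Longrightarrow> prime p \<Longrightarrow> \<exists>I. adic_filtration R I p"
    using R(1) one_mem unfolding good_ring_def by (metis zero_neq_one)
  obtain p where p: "prime p" "p > N" using bigger_prime by blast
  obtain q where q: "prime q" "q > p" using bigger_prime by blast
  obtain I where I: "adic_filtration R I p" using N p by blast
  obtain I' where I': "adic_filtration R I' q" using N[of q] p q by auto
  obtain m where m: "m > 0" "\<And>V. periodic_subvariety (shift_cocycle A) V \<Longrightarrow>
      \<exists>b. period (shift_cocycle A) V dvd m * p ^ b"
    using period_dvd_prime_power[OF I p(1) A B AB] by blast
  obtain m' where m': "m' > 0" "\<And>V. periodic_subvariety (shift_cocycle A) V \<Longrightarrow>
      \<exists>b. period (shift_cocycle A) V dvd m' * q ^ b"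
    using period_dvd_prime_power[OF I' q(1) A B AB] by blast
  have "period (shift_cocycle A) V \<le> m * m'" if V: "periodic_subvariety (shift_cocycle A) V" for V
  proof -
    define n where "n = period (shift_cocycle A) V"
    obtain b c where "n dvd m * p ^ b" "n dvd m' * q ^ c" using m(2)[OF V] m'(2)[OF V] n_def by blast
    then have "n dvd (m * m') * p ^ b" "n dvd (m * m') * q ^ c"
      by (metis dvd_mult2 mult.assoc mult.commute)+
    \<comment> \<open>Powers of two distinct primes are coprime, so both unbounded factors disappear
      and \<open>m * m'\<close> remains.\<close>
    then have "n dvd gcd ((m * m') * p ^ b) ((m * m') * q ^ c)" by simp
    also have "\<dots> = (m * m') * gcd (p ^ b) (q ^ c)" by (simp add: gcd_mult_distrib_nat)
    also have "gcd (p ^ b) (q ^ c) = 1" 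
      using p q primes_coprime[of p q] by (simp add: coprime_imp_gcd_eq_1)
    finally have "n dvd m * m'" by simp
    then show ?thesis using m(1) m'(1) unfolding n_def by (simp add: dvd_imp_le)
  qed
  then show ?thesis by blast
qed

end
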